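(* Let $n\ge 1$, and for $r=1,2$ let $\vec{\alpha_r}=(\alpha_{r1},\dots,\alpha_{rn})$ and $\vec{\beta_r}=(\beta_{r1},\dots,\beta_{rn})$ be vectors with all entries strictly positive. Let $\mathcal{G}_r=\sum_{i=1}^n G_{\alpha_{ri},\beta_{ri}}$, a sum of independent gamma random variables. Then: (1) If $(\vec{\alpha_1},\vec{\beta_1})\ge^a(\vec{\alpha_2},\vec{\beta_2})$, then $\mathcal{G}_1\le_{conv}\mathcal{G}_2$. (2) If $(\vec{\alpha_2},\vec{\beta_2})=^a((\vec{\alpha_2})_\uparrow,(\vec{\beta_2})_\downarrow)$, $\vec{\alpha_1}\prec_w\vec{\alpha_2}$ and $\vec{\beta_1}\prec^w\vec{\beta_2}$, then $\mathcal{G}_1\le_{conv}\mathcal{G}_2$. (3) If $(\vec{\alpha_1},\vec{\beta_1})$ is smaller than $(\vec{\alpha_2},\vec{\beta_2})$ in the reverse-coupled weakly sub-sup majorization order, then $\mathcal{G}_1\le_{conv}\mathcal{G}_2$. (4) If $(\vec{\alpha_2},\vec{\beta_2})=^a((\vec{\alpha_2})_\uparrow,(\vec{\beta_2})_\downarrow)$, $\vec{\alpha_1}\prec_w\vec{\alpha_2}$ and $\log\vec{\beta_1}\prec^w\log\vec{\beta_2}$, then $\mathcal{G}_1\le_{st}\mathcal{G}_2$. (5) If $(\vec{\alpha_1},\log\vec{\beta_1})$ is smaller than $(\vec{\alpha_2},\log\vec{\beta_2})$ in the reverse-coupled weakly sub-sup majorization order, then $\mathcal{G}_1\le_{st}\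mathcal{G}_2$.
   Context: Gamma variables: for $\alpha,\beta>0$, $G_{\alpha,\beta}$ has density $\frac{\beta^\alpha t^{\alpha-1}}{\Gamma(\alpha)}e^{-\beta t}$ for $t\ge0$ and $0$ for $t<0$. Stochastic orders: $X_1\le_{st}X_2$ means $P(X_1\ge t)\le P(X_2\ge t)$ for all $t\in\mathbb{R}$. $X_1\le_{conv}X_2$ means $X_2$ has the same distribution as $X_1+Z$ for some nonnegative random variable $Z$ independent of $X_1$. Vectors: for $\vec{x}\in\mathbb{R}^n$, $\vec{x}_\uparrow=(x_{(1)},\dots,x_{(n)})$ and $\vec{x}_\downarrow=(x_{[1]},\dots,x_{[n]})$ are the vectors of components of $\vec x$ in increasing, resp. decreasing, order; $\log\vec{x}=(\log x_1,\dots,\log x_n)$. $\vec{x}\prec^w\vec{y}$ means $\sum_{i=1}^k x_{(i)}\ge\sum_{i=1}^k y_{(i)}$ for $k=1,\dots,n$. $\vec{x}\prec_w\vec{y}$ means $\sum_{i=1}^k x_{[i]}\le\sum_{i=1}^k y_{[i]}$ for $k=1,\dots,n$. $\vec{x}\prec\vec{y}$ means $\vec{x}\prec_w\vec{y}$ and $\sum_i x_i=\sum_i y_i$. Vector pairs: for pairs in $\mathbb{R}^n\times\mathbb{R}^n$, $(\vec{x_1},\vec{y_1})=^a(\vec{x_2},\vec{y_2})$ means that there is one permutation $\pi$ with $\vec{x_1}=\pi(\vec{x_2})$ and $\vec{y_1}=\pi(\vec{y_2})$. Let $\mathcal{A}$ be the set of vector pairs modulo $=^a$. Arrangement order: $(\vec{x_1},\vec{y_1})\le^a(\vec{x_2},\vec{y_2})$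 (equivalently $(\vec{x_2},\vec{y_2})\ge^a(\vec{x_1},\vec{y_1})$) if there are finitely many vectors $\vec{\phi_1},\dots,\vec{\phi_k}$ with $(\vec{x_1},\vec{y_1})=^a((\vec{x_1})_\uparrow,\vec{\phi_1})$, $((\vec{x_1})_\uparrow,\vec{\phi_k})=^a(\vec{x_2},\vec{y_2})$, and for each $s=1,\dots,k-1$ the vector $\vec{\phi}_{s+1}$ is obtained from $\vec{\phi}_s$ by interchanging two components, at positions $i<j$, where the component at position $i$ is larger than that at position $j$. Reverse-coupled weakly sub-sup majorization order: this is the order on $\mathcal{A}$ generated by the following relations, i.e. $(\vec{x},\vec{y})$ is smaller than $(\vec{x}',\vec{y}')$ if there is a finite chain of elements of $\mathcal{A}$ from $(\vec{x},\vec{y})$ to $(\vec{x}',\vec{y}')$ in which each consecutive pair $(\vec{x_1},\vec{y_1})$, $(\vec{x_2},\vec{y_2})$ satisfies one of: (i) for some $1\le i<j\le n$ with $(y_{2j}-y_{2i})(x_{2j}-x_{2i})\le0$: $(x_{1i},x_{1j})\prec(x_{2i},x_{2j})$, $x_{1m}=x_{2m}$ for $m\ne i,j$, and $\vec{y_1}=\vec{y_2}$; (ii) for some $1\le i<j\le n$ with $(y_{2j}-y_{2i})(x_{2j}-x_{2i})\le0$: $(y_{1i},y_{1j})\prec(y_{2i},y_{2j})$, $y_{1m}=y_{2m}$ for $m\ne i,j$, and $\vec{x_1}=\vec{x_2}$; (iii) $x_{1i}\le x_{2i}$ for all $i$ and $\vec{y_1}=\vec{y_2}$; (iv) $y_{1i}\ge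 y_{2i}$ for all $i$ and $\vec{x_1}=\vec{x_2}$. *)

theory Defs
  imports "HOL-Probability.Probability" "HOL-Combinatorics.Permutations"
begin

section \<open>Gamma distributions\<close>

text \<open>For \<open>\<alpha> \<le> 1\<close> the value at \<open>t = 0\<close> may differ from the analytic
  convention, since \<open>0 powr a = 0\<close>; this affects a null set only.\<close>

definition gamma_density :: "real \<Rightarrow> real \<Rightarrow> real \<Rightarrow> real" where
  "gamma_density \<alpha> \<beta> t =
     (if t < 0 then 0 else \<beta> powr \<alpha> * t powr (\<alpha> - 1) / Gamma \<alpha> * exp (- \<beta> * t))"


section \<open>Stochastic orders\<close>

definition st_le :: "'a measure \<Rightarrow> ('a \<Rightarrow> real) \<Rightarrow> 'b measure \<Rightarrow> ('b \<Rightarrow> real) \<Rightarrow> bool" where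
  "st_le M\<^sub>1 X\<^sub>1 M\<^sub>2 X\<^sub>2 \<longleftrightarrow>
     (\<forall>t. measure M\<^sub>1 {\<omega> \<in> space M\<^sub>1. t \<le> X\<^sub>1 \<omega>} \<le> measure M\<^sub>2 {\<omega> \<in> space M\<^sub>2. t \<le> X\<^sub>2 \<omega>})"

text \<open>The given space \<open>M\<^sub>1\<close> need not be rich enough to carry a variable \<open>Z\<close> independent of
  \<open>X\<^sub>1\<close>, so \<open>X\<^sub>1\<close> is replaced by a copy \<open>X\<close> with the same distribution on some probability
  space. Sample spaces of type \<^typ>\<open>real \<times> real\<close> suffice, because only the joint
  distribution of \<open>X\<close> and \<open>Z\<close> matters.\<close>

definition conv_le :: "'a measure \<Rightarrow> ('a \<Rightarrow> real) \<Rightarrow> 'b measure \<Rightarrow> ('b \<Rightarrow> real) \<Rightarrow> bool" where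
  "conv_le M\<^sub>1 X\<^sub>1 M\<^sub>2 X\<^sub>2 \<longleftrightarrow>
     (\<exists>(N :: (real \<times> real) measure) X Z.
        prob_space N \<and>
        prob_space.indep_var N borel X borel Z \<and>
        (\<forall>\<omega> \<in> space N. 0 \<le> Z \<omega>) \<and>
        distr N borel X = distr M\<^sub>1 borel X\<^sub>1 \<and>
        distr M\<^sub>2 borel X\<^sub>2 = distr N borel (\<lambda>\<omega>. X \<omega> + Z \<omega>))"


section \<open>Majorization\<close>

text \<open>Vectors in \<open>\<real>\<^sup>n\<close> are lists of length \<open>n\<close>, with components indexed from \<open>0\<close>.\<close>

definition increasing_vec :: "real list \<Rightarrow> real list" where
  "increasing_vec x = sort x"

definition decreasing_vec :: "real list \<Rightarrow> real list" where
  "decreasing_vec x = rev (sort x)"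

definition weak_sup_major :: "real list \<Rightarrow> real list \<Rightarrow> bool" where
  "weak_sup_major x y \<longleftrightarrow> length x = length y \<and>
     (\<forall>k \<in> {1..length x}. sum_list (take k (increasing_vec x)) \<ge> sum_list (take k (increasing_vec y)))"

definition weak_sub_major :: "real list \<Rightarrow> real list \<Rightarrow> bool" where
  "weak_sub_major x y \<longleftrightarrow> length x = length y \<and>
     (\<forall>k \<in> {1..length x}. sum_list (take k (decreasing_vec x)) \<le> sum_list (take k (decreasing_vec y)))"

definition major :: "real list \<Rightarrow> real list \<Rightarrow> bool" where
  "major x y \<longleftrightarrow> weak_sub_major x y \<and> sum_list x = sum_list y"


section \<open>Orders on pairs of vectors\<close>

definition arr_eq :: "real list \<times> real list \<Rightarrow> real list \<times> real list \<Rightarrow> bool" where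
  "arr_eq = (\<lambda>(x\<^sub>1, y\<^sub>1) (x\<^sub>2, y\<^sub>2). length x\<^sub>2 = length y\<^sub>2 \<and>
     (\<exists>\<pi>. \<pi> permutes {..<length x\<^sub>2} \<and>
        x\<^sub>1 = permute_list \<pi> x\<^sub>2 \<and> y\<^sub>1 = permute_list \<pi> y\<^sub>2))"

definition sorting_swap :: "real list \<Rightarrow> real list \<Rightarrow> bool" where
  "sorting_swap \<phi> \<psi> \<longleftrightarrow>
     (\<exists>i j. i < j \<and> j < length \<phi> \<and> \<phi> ! i > \<phi> ! j \<and> \<psi> = \<phi>[i := \<phi> ! j, j := \<phi> ! i])"

text \<open>The list \<open>\<phi>\<close> below is the sequence of vectors \<open>\<phi>\<^sub>1, \<dots>, \<phi>\<^sub>k\<close> with \<open>k \<ge> 1\<close>.\<close>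

definition arr_le :: "real list \<times> real list \<Rightarrow> real list \<times> real list \<Rightarrow> bool" where
  "arr_le = (\<lambda>(x\<^sub>1, y\<^sub>1) (x\<^sub>2, y\<^sub>2). \<exists>\<phi> :: real list list. \<phi> \<noteq> [] \<and>
     arr_eq (x\<^sub>1, y\<^sub>1) (increasing_vec x\<^sub>1, hd \<phi>) \<and>
     arr_eq (increasing_vec x\<^sub>1, last \<phi>) (x\<^sub>2, y\<^sub>2) \<and>
     successively sorting_swap \<phi>)"

text \<open>One step \<open>(x\<^sub>1, y\<^sub>1)\<close>, \<open>(x\<^sub>2, y\<^sub>2)\<close> of the reverse-coupled weakly sub-sup majorization
  order in dimension \<open>n\<close>. The order lives on pairs modulo \<^const>\<open>arr_eq\<close>; taking
  \<^const>\<open>arr_eq\<close> itself as a further generating relation (rule \<open>perm\<close>) amounts to choosing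
  a new representative of a class. The vectors in a chain are arbitrary real vectors; they
  are not required to be positive.\<close>

inductive rc_step ::
  "nat \<Rightarrow> real list \<times> real list \<Rightarrow> real list \<times> real list \<Rightarrow> bool" for n :: nat where
  spread_fst:
    "\<lbrakk>length x\<^sub>1 = n; length x\<^sub>2 = n; length y = n; i < j; j < n;
      (y ! j - y ! i) * (x\<^sub>2 ! j - x\<^sub>2 ! i) \<le> 0;
      major [x\<^sub>1 ! i, x\<^sub>1 ! j] [x\<^sub>2 ! i, x\<^sub>2 ! j];
      \<forall>m<n. m \<noteq> i \<longrightarrow> m \<noteq> j \<longrightarrow> x\<^sub>1 ! m = x\<^sub>2 ! m\<rbrakk>
     \<Longrightarrow> rc_step n (x\<^sub>1, y) (x\<^sub>2, y)"
| spread_snd: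
    "\<lbrakk>length x = n; length y\<^sub>1 = n; length y\<^sub>2 = n; i < j; j < n;
      (y\<^sub>2 ! j - y\<^sub>2 ! i) * (x ! j - x ! i) \<le> 0;
      major [y\<^sub>1 ! i, y\<^sub>1 ! j] [y\<^sub>2 ! i, y\<^sub>2 ! j];
      \<forall>m<n. m \<noteq> i \<longrightarrow> m \<noteq> j \<longrightarrow> y\<^sub>1 ! m = y\<^sub>2 ! m\<rbrakk>
     \<Longrightarrow> rc_step n (x, y\<^sub>1) (x, y\<^sub>2)"
| raise_fst:
    "\<lbrakk>length x\<^sub>1 = n; length x\<^sub>2 = n; length y = n; \<forall>i<n. x\<^sub>1 ! i \<le> x\<^sub>2 ! i\<rbrakk>
     \<Longrightarrow> rc_step n (x\<^sub>1, y) (x\<^sub>2, y)"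
| lower_snd:
    "\<lbrakk>length x = n; length y\<^sub>1 = n; length y\<^sub>2 = n; \<forall>i<n. y\<^sub>1 ! i \<ge> y\<^sub>2 ! i\<rbrakk>
     \<Longrightarrow> rc_step n (x, y\<^sub>1) (x, y\<^sub>2)"
| perm:
    "\<lbrakk>length x\<^sub>2 = n; length y\<^sub>2 = n; arr_eq (x\<^sub>1, y\<^sub>1) (x\<^sub>2, y\<^sub>2)\<rbrakk>
     \<Longrightarrow> rc_step n (x\<^sub>1, y\<^sub>1) (x\<^sub>2, y\<^sub>2)"

definition rc_le :: "nat \<Rightarrow> real list \<times> real list \<Rightarrow> real list \<times> real list \<Rightarrow> bool" where
  "rc_le n = (rc_step n)\<^sup>*\<^sup>*"

end

theory Submission
  imports Defs
begin

text \<open>A sum of independent gamma variables has Laplace transform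
  \<open>L s = (\<Prod>i<n. (\<beta> i / (\<beta> i + s)) powr \<alpha> i)\<close>, and it precedes another one in the convolution order
  as soon as the quotient of the transforms is itself the transform of a law on the half-line. If the
  total shapes agree, this quotient is of compound Poisson type provided that
  \<open>(\<Sum>i<n. \<alpha>\<^sub>1 i * exp (- \<beta>\<^sub>1 i * x)) \<le> (\<Sum>i<n. \<alpha>\<^sub>2 i * exp (- \<beta>\<^sub>2 i * x))\<close> for all \<open>x > 0\<close>; missing total
  shape is added as a further gamma factor. All comparisons in the convolution order reduce to
  this pointwise inequality, which follows from convexity of the exponential or, for oppositely ordered
  vectors, from Abel summation.

  The usual stochastic order is tested on polynomials in \<open>exp (- X)\<close>, whose expectations are linear
  combinations of values of \<open>L\<close>. When only the rates change, the vectors of log-rates are joined by a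
  segment, and the sign of the derivative of such an expectation along it is again decided by a pointwise
  inequality between sums of exponentials.\<close>

section \<open>Laplace transforms\<close>

text \<open>Near 0 the intensity attached to a quotient of two gamma transforms behaves like the
  difference of the total shapes divided by x. Equal totals keep the number of jumps finite, so that
  compound Poisson laws can stand in for general infinitely divisible ones.

  The polynomials serve a second purpose: they recover every tail of a law on the half-line from its
  transform, so a law is identified by its transform along the way.

  Along a segment of log-rates the logarithm of the transform changes at a rate equal to minus s
  times the transform of a nonnegative function k. If k were also nonincreasing, it would be the
  tail of a jump intensity and the convolution order would follow. The argument controls only the
  sign of k, which is enough to compare tails.

  The comparisons are stated for vectors of shapes and rates instead of random variables, because
  the intermediate vectors of a chain need not have positive shapes.\<close>

definition nonneg_law :: "real measure \<Rightarrow> bool" where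
  "nonneg_law N \<longleftrightarrow> prob_space N \<and> sets N = sets borel \<and> (AE x in N. 0 \<le> x)"

definition laplace :: "real measure \<Rightarrow> real \<Rightarrow> real" where
  "laplace N s = (\<integral>x. exp (- s * x) \<partial>N)"

definition laplace_prob :: "(real \<Rightarrow> real) \<Rightarrow> bool" where
  "laplace_prob \<psi> \<longleftrightarrow> (\<exists>N. nonneg_law N \<and> (\<forall>s\<ge>0. laplace N s = \<psi> s))"

lemma nonneg_lawD:
  assumes "nonneg_law N"
  shows "prob_space N" "sets N = sets borel" "space N = UNIV" "AE x in N. 0 \<le> x"
    "measurable N = measurable borel"
  using assms sets_eq_imp_space_eq[of N borel] by (auto simp: nonneg_law_def fun_eq_iff intro:
      measurable_cong_sets)

lemma integrable_nonneg_law: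
  fixes f :: "real \<Rightarrow> real"
  assumes N: "nonneg_law N" and f: "f \<in> borel_measurable borel"
    and B: "\<And>x. 0 \<le> x \<Longrightarrow> \<bar>f x\<bar> \<le> B"
  shows "integrable N f"
proof -
  interpret prob_space N using nonneg_lawD(1)[OF N] .
  show ?thesis
    by (rule integrable_const_bound[where B=B])
      (use nonneg_lawD(4)[OF N] f B in \<open>auto simp: nonneg_lawD(5)[OF N]\<close>)
qed

lemma integrable_exp_nonneg_law:
  assumes "nonneg_law N" "0 \<le> s"
  shows "integrable N (\<lambda>x. exp (- s * x))"
  by (rule integrable_nonneg_law[OF assms(1), where B=1]) (use assms(2) in auto)

lemma nn_laplace:
  assumes N: "nonneg_law N" and s: "0 \<le> s"
  shows "(\<integral>\<^sup>+x. ennreal (exp (- s * x)) \<partial>N) = ennreal (laplace N s)"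
  unfolding laplace_def using integrable_exp_nonneg_law[OF N s]
  by (intro nn_integral_eq_integral) auto

text \<open>Transforms of convolutions, mixtures and densities are computed as nonnegative
  integrals, which spares integrability side conditions.\<close>

lemma laplace_eqI:
  assumes N: "nonneg_law N" and "0 \<le> r"
    and e: "(\<integral>\<^sup>+x. ennreal (exp (- s * x)) \<partial>N) = ennreal r"
  shows "laplace N s = r"
proof -
  have "laplace N s = enn2real (\<integral>\<^sup>+x. ennreal (exp (- s * x)) \<partial>N)"
    unfolding laplace_def
    by (intro integral_eq_nn_integral) (auto simp: nonneg_lawD(5)[OF N])
  with e assms(2) show ?thesis by simp
qed

lemma laplace_nonneg: "0 \<le> laplace N s"
  by (simp add: laplace_def)

section \<open>Closure of the class of transforms under products and compound Poisson sums\<close>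

lemma laplace_prob_one: "laplace_prob (\<lambda>s. 1)"
  unfolding laplace_prob_def
proof (intro exI conjI allI impI)
  show "nonneg_law (return borel 0)"
    by (auto simp: nonneg_law_def AE_return intro: prob_space_return)
  show "laplace (return borel 0) s = 1" for s
    by (simp add: laplace_def integral_return)
qed

lemma nonneg_law_convolution:
  assumes M: "nonneg_law M" and N: "nonneg_law N"
  shows "nonneg_law (M \<star> N)"
    and "0 \<le> s \<Longrightarrow> laplace (M \<star> N) s = laplace M s * laplace N s"
proof -
  note [simp] = nonneg_lawD(2,3)[OF M] nonneg_lawD(2,3)[OF N]
  have [measurable_cong]: "sets M = sets borel" "sets N = sets borel" by auto
  interpret M: prob_space M using nonneg_lawD(1)[OF M] .
  interpret N: prob_space N using nonneg_lawD(1)[OF N] .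
  interpret MN: pair_prob_space M N ..
  have "AE p in M \<Otimes>\<^sub>M N. 0 \<le> fst p + snd p"
  proof -
    have "AE x in M. AE y in N. 0 \<le> x + y"
      using nonneg_lawD(4)[OF M]
    proof eventually_elim
      case (elim x)
      show ?case using nonneg_lawD(4)[OF N] by eventually_elim (use elim in auto)
    qed
    moreover have "{p \<in> space (M \<Otimes>\<^sub>M N). 0 \<le> fst p + snd p} \<in> sets (M \<Otimes>\<^sub>M N)"
      by measurable
    ultimately show ?thesis
      by (intro MN.AE_pair_measure) auto
  qed
  then show 1: "nonneg_law (M \<star> N)"
    unfolding nonneg_law_def convolution_def
    by (auto simp: AE_distr_iff case_prod_beta intro!: MN.prob_space_distr)
  show "laplace (M \<star> N) s = laplace M s * laplace N s" if s: "0 \<le> s"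
  proof (rule laplace_eqI[OF 1])
    show "0 \<le> laplace M s * laplace N s" by (simp add: laplace_nonneg)
    have "(\<integral>\<^sup>+x. ennreal (exp (- s * x)) \<partial>(M \<star> N))
      = (\<integral>\<^sup>+x. \<integral>\<^sup>+y. ennreal (exp (- s * (x + y))) \<partial>N \<partial>M)"
      by (intro nn_integral_convolution M.finite_measure_axioms N.finite_measure_axioms) auto
    also have "\<dots> = (\<integral>\<^sup>+x. ennreal (exp (- s * x)) * (\<integral>\<^sup>+y. ennreal (exp (- s * y)) \<partial>N) \<partial>M)"
      by (subst nn_integral_cmult[symmetric])
        (auto simp: ennreal_mult'[symmetric] exp_add[symmetric] algebra_simps)
    also have "\<dots> = ennreal (laplace M s * laplace N s)"
      by (simp add: nn_laplace[OF N s] nn_integral_multc ennreal_mult' laplace_nonneg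
        nn_laplace[OF M s, simplified] nn_laplace[OF N s, simplified])
    finally show "(\<integral>\<^sup>+x. ennreal (exp (- s * x)) \<partial>(M \<star> N)) = \<dots>" .
  qed
qed

lemma laplace_prob_mult:
  assumes "laplace_prob \<phi>" "laplace_prob \<psi>"
  shows "laplace_prob (\<lambda>s. \<phi> s * \<psi> s)"
  using assms nonneg_law_convolution unfolding laplace_prob_def by metis

lemma laplace_prob_cong:
  assumes "laplace_prob \<phi>" "\<And>s. 0 \<le> s \<Longrightarrow> \<phi> s = \<psi> s"
  shows "laplace_prob \<psi>"
  using assms unfolding laplace_prob_def by metis

lemma laplace_prob_prod:
  assumes "finite I" "\<And>i. i \<in> I \<Longrightarrow> laplace_prob (\<psi> i)"
  shows "laplace_prob (\<lambda>s. \<Prod>i\<in>I. \<psi> i s)"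
  using assms by (induction I rule: finite_induct) (auto intro: laplace_prob_one laplace_prob_mult)

lemma laplace_prob_power:
  assumes "laplace_prob \<psi>" shows "laplace_prob (\<lambda>s. \<psi> s ^ k)"
  using laplace_prob_prod[of "{..<k}" "\<lambda>_. \<psi>"] assms by simp

text \<open>The witness is the law of a sum of a Poisson number, with mean \<open>c\<close>, of
  independent jumps: a Poisson mixture of laws with transforms \<open>\<psi> s ^ k\<close>. Its
  transform is the Poisson generating function at \<open>\<psi> s\<close>, that is, the exponential
  series.\<close>

lemma laplace_prob_compound_Poisson:
  assumes L: "laplace_prob \<psi>" and c: "0 < c"
  shows "laplace_prob (\<lambda>s. exp (c * (\<psi> s - 1)))"
proof -
  have "\<forall>k. \<exists>N. nonneg_law N \<and> (\<forall>s\<ge>0. laplace N s = \<psi> s ^ k)"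
    using laplace_prob_power[OF L] unfolding laplace_prob_def by blast
  then obtain N where N: "\<And>k. nonneg_law (N k)" and LN: "\<And>k s. 0 \<le> s \<Longrightarrow> laplace (N k) s = \<psi> s ^ k"
    by metis
  have \<psi>_nonneg: "0 \<le> \<psi> s" if "0 \<le> s" for s
    using LN[OF that, of 1] laplace_nonneg[of "N 1" s] by simp
  define P where "P = measure_pmf (poisson_pmf c)"
  have sp: "space (N k) = UNIV" "sets (N k) = sets borel" for k using nonneg_lawD[OF N] by auto
  have meas[measurable]: "N \<in> P \<rightarrow>\<^sub>M subprob_algebra borel"
    unfolding P_def
    by (auto simp: measurable_pmf_measure1 space_subprob_algebra sp intro!:
        prob_space_imp_subprob_space nonneg_lawD(1)[OF N])
  interpret P: prob_space P unfolding P_def by (rule prob_space_measure_pmf)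
  have spP: "space P = UNIV" by (simp add: P_def)
  have 1: "nonneg_law (P \<bind> N)"
    unfolding nonneg_law_def
  proof (intro conjI)
    show "prob_space (P \<bind> N)"
      by (rule P.prob_space_bind[OF _ meas]) (simp add: nonneg_lawD(1)[OF N])
    show "sets (P \<bind> N) = sets borel" by (rule sets_bind) (auto simp: sp spP)
    show "AE x in P \<bind> N. 0 \<le> x"
      by (subst AE_bind[OF meas]) (auto simp: nonneg_lawD(4)[OF N])
  qed
  show ?thesis unfolding laplace_prob_def
  proof (intro exI conjI allI impI)
    show "nonneg_law (P \<bind> N)" by fact
    fix s :: real assume s: "0 \<le> s"
    show "laplace (P \<bind> N) s = exp (c * (\<psi> s - 1))"
    proof (rule laplace_eqI[OF 1])
      have "(\<integral>\<^sup>+x. ennreal (exp (- s * x)) \<partial>(P \<bind> N)) =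
          (\<integral>\<^sup>+k. \<integral>\<^sup>+x. ennreal (exp (- s * x)) \<partial>N k \<partial>P)"
        by (rule nn_integral_bind[OF _ meas]) auto
      also have "\<dots> = (\<integral>\<^sup>+k. ennreal (\<psi> s ^ k) \<partial>P)"
        by (simp only: nn_laplace[OF N s] LN[OF s])
      also have "\<dots> = (\<Sum>k. ennreal (c ^ k / fact k * exp (- c) * \<psi> s ^ k))"
        unfolding P_def using c
        by (simp add: nn_integral_measure_pmf nn_integral_count_space_nat \<psi>_nonneg[OF s]
            ennreal_mult'[symmetric])
      also have "\<dots> = ennreal (exp (c * (\<psi> s - 1)))"
      proof (rule suminf_ennreal_eq)
        have "(\<lambda>k. exp (- c) * ((c * \<psi> s) ^ k /\<^sub>R fact k)) sums (exp (- c) * exp (c * \<psi> s))"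
          by (intro sums_mult exp_converges)
        also have "exp (- c) * exp (c * \<psi> s) = exp (c * (\<psi> s - 1))"
          by (simp add: exp_add[symmetric] algebra_simps)
        also have "(\<lambda>k. exp (- c) * ((c * \<psi> s) ^ k /\<^sub>R fact k)) = (\<lambda>k. c ^ k / fact k * exp
            (- c) * \<psi> s ^ k)"
          by (auto simp: field_simps)
        finally show "(\<lambda>k. c ^ k / fact k * exp (- c) * \<psi> s ^ k) sums exp (c * (\<psi> s - 1))" .
      qed (use c \<psi>_nonneg[OF s] in auto)
      finally show "(\<integral>\<^sup>+x. ennreal (exp (- s * x)) \<partial>(P \<bind> N)) = \<dots>" .
    qed auto
  qed
qed

section \<open>Stochastic orders through Laplace transforms\<close>

definition poly_laplace :: "(real \<Rightarrow> real) \<Rightarrow> real poly \<Rightarrow> real" where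
  "poly_laplace L p = (\<Sum>i\<le>degree p. coeff p i * L (real i))"

text \<open>If p increases on [0,1], then p(exp(-X)) decreases in X; this is why the inequality
  between the expectations is reversed. Only the functions enter, so that transitivity and
  differentiation along a path do not mention laws.\<close>

definition laplace_st_le :: "(real \<Rightarrow> real) \<Rightarrow> (real \<Rightarrow> real) \<Rightarrow> bool" where
  "laplace_st_le L\<^sub>1 L\<^sub>2 \<longleftrightarrow> (\<forall>p. (\<forall>y\<in>{0..1}. 0 \<le> poly (pderiv p) y) \<longrightarrow>
     poly_laplace L\<^sub>2 p \<le> poly_laplace L\<^sub>1 p)"

section \<open>Recovering tails from polynomials in exp(-X)\<close>

lemma poly_laplace_integral:
  assumes N: "nonneg_law N"
  shows "poly_laplace (laplace N) p = (\<integral>x. poly p (exp (- x)) \<partial>N)"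
proof -
  have "(\<integral>x. poly p (exp (- x)) \<partial>N) = (\<integral>x. (\<Sum>i\<le>degree p. coeff p i * exp (- real i * x)) \<partial>N)"
    by (simp add: poly_altdef exp_of_nat_mult[symmetric])
  also have "\<dots> = (\<Sum>i\<le>degree p. coeff p i * laplace N i)"
    using integrable_exp_nonneg_law[OF N] by (subst Bochner_Integration.integral_sum)
        (auto simp: laplace_def)
  finally show ?thesis by (simp add: poly_laplace_def)
qed

text \<open>With q = exp(-nx) and an exponent m close to n exp(nu), the power (1 - q)^m is roughly
  exp(-mq), where mq is close to n exp(n(u - x)). This tends to 0 for x > u and to infinity for x
  \<le> u. The extra factor n settles the boundary case x = u.\<close>

lemma tendsto_power_indicator:
  fixes u x :: real
  assumes "0 \<le> u" "0 \<le> x"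
  shows "(\<lambda>n. (1 - exp (- real n * x)) ^ nat \<lceil>real n * exp (real n * u)\<rceil>) \<longlonglongrightarrow> indicator {u<..} x"
proof -
  define M where "M n = nat \<lceil>real n * exp (real n * u)\<rceil>" for n :: nat
  have M: "real n * exp (real n * u) \<le> real (M n)" "real (M n) \<le> real n * exp (real n * u) + 1" for n
    unfolding M_def by (auto simp: of_nat_nat)
  have q: "0 \<le> exp (- real n * x)" "exp (- real n * x) \<le> 1" for n :: nat using assms by auto
  show ?thesis
  proof (cases "u < x")
    case True
    have r: "norm (exp (- (x - u))) < 1" "norm (exp (- x)) < 1" using True assms by auto
    have "(\<lambda>n. 1 - (real n * exp (- (x - u)) ^ n + exp (- x) ^ n)) \<longlonglongrightarrow> 1 - (0 + 0)"
      by (intro tendsto_intros powser_times_n_limit_0 LIMSEQ_power_zero r)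
    then have lim: "(\<lambda>n. 1 - (real n * exp (- (x - u)) ^ n + exp (- x) ^ n)) \<longlonglongrightarrow> 1" by simp
    \<comment> \<open>Bernoulli's inequality bounds the power below by 1 - mq; the summand
      \<open>exp (- x) ^ n\<close> pays for rounding the exponent up.\<close>
    have low: "1 - (real n * exp (- (x - u)) ^ n + exp (- x) ^ n) \<le> (1 - exp (- real n * x)) ^ M n" for n
    proof -
      have "real (M n) * exp (- real n * x) \<le> (real n * exp (real n * u) + 1) * exp (- real n * x)"
        by (intro mult_right_mono M) auto
      also have "\<dots> = real n * exp (- (x - u)) ^ n + exp (- x) ^ n"
        by (simp add: exp_of_nat_mult[symmetric] algebra_simps exp_add[symmetric])
      finally have "1 - (real n * exp (- (x - u)) ^ n + exp (- x) ^ n) \<le> 1 + real (M n) * (- exp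
          (- real n * x))"
        by simp
      also have "\<dots> \<le> (1 + - exp (- real n * x)) ^ M n"
        using q[of n] by (intro Bernoulli_inequality) auto
      finally show ?thesis by simp
    qed
    have "(\<lambda>n. (1 - exp (- real n * x)) ^ M n) \<longlonglongrightarrow> 1"
      by (rule tendsto_sandwich[OF _ _ lim tendsto_const])
        (use low q in \<open>auto intro!: always_eventually power_le_one simp: \<open>0 \<le> x\<close>\<close>)
    then show ?thesis using True by (simp add: M_def)
  next
    case False
    \<comment> \<open>Here 1 - q \<le> exp(-q) and mq \<ge> n, since x \<le> u.\<close>
    have up: "(1 - exp (- real n * x)) ^ M n \<le> exp (- 1) ^ n" for n
    proof -
      have "(1 - exp (- real n * x)) ^ M n \<le> exp (- exp (- real n * x)) ^ M n"
        using q[of n] exp_ge_add_one_self[of "- exp (- real n * x)"] by (intro power_mono) auto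
      also have "\<dots> = exp (- (real (M n) * exp (- real n * x)))"
        by (simp add: exp_of_nat_mult[symmetric])
      also have "\<dots> \<le> exp (- real n)"
      proof -
        have "real n * 1 \<le> real n * exp (real n * u - real n * x)"
          using False by (intro mult_left_mono) (auto simp: mult_left_mono)
        also have "\<dots> = (real n * exp (real n * u)) * exp (- real n * x)"
          by (simp add: exp_add[symmetric])
        also have "\<dots> \<le> real (M n) * exp (- real n * x)"
          by (intro mult_right_mono M) auto
        finally show ?thesis by simp
      qed
      also have "\<dots> = exp (- 1) ^ n" by (simp add: exp_of_nat_mult[symmetric])
      finally show ?thesis .
    qed
    have lim: "(\<lambda>n. exp (- 1 :: real) ^ n) \<longlonglongrightarrow> 0" by (intro LIMSEQ_power_zero) simp
    have "(\<lambda>n. (1 - exp (- real n * x)) ^ M n) \<longlonglongrightarrow> 0"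
      by (rule tendsto_sandwich[OF _ _ tendsto_const lim])
        (use up q in \<open>auto intro!: zero_le_power always_eventually simp: \<open>0 \<le> x\<close>\<close>)
    then show ?thesis using False by (simp add: M_def)
  qed
qed

text \<open>The approximations of the indicator are polynomials in exp(-x) bounded by 1 on the
  half-line, so dominated convergence carries the inequality from test polynomials to tails. For u <
  0 both tails have mass 1.\<close>

lemma laplace_st_le_greaterThan:
  assumes N1: "nonneg_law N\<^sub>1" and N2: "nonneg_law N\<^sub>2"
    and le: "laplace_st_le (laplace N\<^sub>1) (laplace N\<^sub>2)"
  shows "measure N\<^sub>1 {u<..} \<le> measure N\<^sub>2 {u<..}"
proof (cases "u < 0")
  case True
  have "measure N {u<..} = 1" if N: "nonneg_law N" for N
  proof -
    interpret prob_space N using nonneg_lawD(1)[OF N] .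
    have "AE x in N. x \<in> {u<..}" using nonneg_lawD(4)[OF N] by eventually_elim (use True in auto)
    then show ?thesis by (intro prob_eq_1[THEN iffD2]) (auto simp: nonneg_lawD(2)[OF N])
  qed
  with N1 N2 show ?thesis by simp
next
  case False
  define f where "f n x = (1 - exp (- real n * x)) ^ nat \<lceil>real n * exp (real n * u)\<rceil>" for n and x :: real
  have lim: "(\<lambda>n. \<integral>x. f n x \<partial>N) \<longlonglongrightarrow> measure N {u<..}" if N: "nonneg_law N" for N
  proof -
    interpret prob_space N using nonneg_lawD(1)[OF N] .
    have "(\<lambda>n. \<integral>x. f n x \<partial>N) \<longlonglongrightarrow> (\<integral>x. indicator {u<..} x \<partial>N)"
    proof (rule integral_dominated_convergence[where w="\<lambda>_. 1"])
      show "AE x in N. (\<lambda>n. f n x) \<longlonglongrightarrow> indicator {u<..} x"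
        using nonneg_lawD(4)[OF N]
        by eventually_elim (use tendsto_power_indicator[of u] False in \<open>auto simp: f_def\<close>)
      show "AE x in N. norm (f n x) \<le> 1" for n
        using nonneg_lawD(4)[OF N]
        by eventually_elim (auto simp: f_def norm_power intro!: power_le_one)
    qed (auto simp: f_def nonneg_lawD(5)[OF N])
    then show ?thesis by (simp add: nonneg_lawD(3)[OF N])
  qed
  have "(\<integral>x. f n x \<partial>N\<^sub>1) \<le> (\<integral>x. f n x \<partial>N\<^sub>2)" for n
  proof -
    define m where "m = nat \<lceil>real n * exp (real n * u)\<rceil>"
    \<comment> \<open>The power (1 - y^n)^m decreases in y on [0,1]; the minus sign makes it an
      admissible test polynomial.\<close>
    define p :: "real poly" where "p = - ((1 - monom 1 n) ^ m)"
    have p: "poly p (exp (- x)) = - f n x" for x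
      by (simp add: p_def f_def m_def poly_monom exp_of_nat_mult[symmetric])
    have "0 \<le> poly (pderiv p) y" if "y \<in> {0..1}" for y
      using that
      by (simp add: p_def pderiv_minus pderiv_power pderiv_diff pderiv_monom poly_monom power_le_one)
    then have "poly_laplace (laplace N\<^sub>2) p \<le> poly_laplace (laplace N\<^sub>1) p"
      using le unfolding laplace_st_le_def by blast
    then show ?thesis by (simp add: poly_laplace_integral N1 N2 p)
  qed
  then show ?thesis
    using LIMSEQ_le[OF lim[OF N1] lim[OF N2]] by auto
qed

text \<open>The usual stochastic order is stated with closed half-lines, while the polynomial limit
  produces open ones; a closed half-line is a decreasing intersection of open ones.\<close>

lemma laplace_st_le_atLeast:
  assumes N1: "nonneg_law N\<^sub>1" and N2: "nonneg_law N\<^sub>2"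
    and le: "laplace_st_le (laplace N\<^sub>1) (laplace N\<^sub>2)"
  shows "measure N\<^sub>1 {t..} \<le> measure N\<^sub>2 {t..}"
proof -
  have lim: "(\<lambda>n. measure N {t - 1 / real (Suc n)<..}) \<longlonglongrightarrow> measure N {t..}" if N: "nonneg_law N" for N
  proof -
    interpret prob_space N using nonneg_lawD(1)[OF N] .
    have "(\<lambda>n. measure N {t - 1 / real (Suc n)<..}) \<longlonglongrightarrow> measure N (\<Inter>n. {t - 1 / real (Suc n)<..})"
      by (rule finite_Lim_measure_decseq)
        (auto simp: nonneg_lawD(2)[OF N] decseq_def frac_le intro: order.strict_trans1[rotated] )
    also have "(\<Inter>n. {t - 1 / real (Suc n)<..}) = {t..}"
    proof (intro equalityI subsetI)
      fix x assume x: "x \<in> (\<Inter>n. {t - 1 / real (Suc n)<..})"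
      have "(\<lambda>n. t - 1 / real (Suc n)) \<longlonglongrightarrow> t - 0"
        by (intro tendsto_intros LIMSEQ_Suc[OF lim_1_over_n])
      moreover have "t - 1 / real (Suc n) \<le> x" for n using x by (auto intro: less_imp_le)
      ultimately have "t - 0 \<le> x" by (intro LIMSEQ_le_const2) auto
      then show "x \<in> {t..}" by simp
    qed (auto simp: intro: order.strict_trans2[rotated])
    finally show ?thesis .
  qed
  show ?thesis
    using LIMSEQ_le[OF lim[OF N1] lim[OF N2]] laplace_st_le_greaterThan[OF assms] by auto
qed

text \<open>Equal transforms give the comparison in both directions, hence equal tails.\<close>

lemma nonneg_law_eqI:
  assumes N1: "nonneg_law N\<^sub>1" and N2: "nonneg_law N\<^sub>2"
    and e: "\<And>s. 0 \<le> s \<Longrightarrow> laplace N\<^sub>1 s = laplace N\<^sub>2 s"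
  shows "N\<^sub>1 = N\<^sub>2"
proof (rule measure_eqI_lessThan)
  interpret N1: prob_space N\<^sub>1 using nonneg_lawD(1)[OF N1] .
  interpret N2: prob_space N\<^sub>2 using nonneg_lawD(1)[OF N2] .
  show "emeasure N\<^sub>1 {x<..} < \<infinity>" for x by (simp add: N1.emeasure_finite less_top[symmetric])
  have "laplace_st_le (laplace N\<^sub>1) (laplace N\<^sub>2)" "laplace_st_le (laplace N\<^sub>2) (laplace N\<^sub>1)"
    by (auto simp: laplace_st_le_def poly_laplace_def e)
  then have "measure N\<^sub>1 {x<..} = measure N\<^sub>2 {x<..}" for x
    by (intro antisym laplace_st_le_greaterThan N1 N2)
  then show "emeasure N\<^sub>1 {x<..} = emeasure N\<^sub>2 {x<..}" for x
    by (simp add: N1.emeasure_eq_measure N2.emeasure_eq_measure)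
qed (use nonneg_lawD(2)[OF N1] nonneg_lawD(2)[OF N2] in auto)

text \<open>An independent summand Z \<ge> 0 with law \<open>M\<close> multiplies exp(-X) by exp(-Z)
  \<le> 1 and so lowers the value of an increasing polynomial. Integrating over z for fixed x turns
  this into a pointwise bound under \<open>N\<close>.\<close>

lemma laplace_st_le_mult:
  assumes N: "nonneg_law N" and M: "nonneg_law M"
  shows "laplace_st_le (laplace N) (\<lambda>s. laplace N s * laplace M s)"
  unfolding laplace_st_le_def
proof (intro allI impI)
  fix p :: "real poly" assume p: "\<forall>y\<in>{0..1}. 0 \<le> poly (pderiv p) y"
  interpret M: prob_space M using nonneg_lawD(1)[OF M] .
  have int: "integrable M (\<lambda>z. poly p (exp (- x) * exp (- z)))"
    "(\<integral>z. poly p (exp (- x) * exp (- z)) \<partial>M) = (\<Sum>i\<le>degree p. coeff p i * laplace M i * exp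
        (- real i * x))" for x
  proof -
    have *: "poly p (exp (- x) * exp (- z)) = (\<Sum>i\<le>degree p. coeff p i * exp (- real i * x) * exp
        (- real i * z))" for z
      by (simp add: poly_altdef power_mult_distrib exp_of_nat_mult[symmetric] mult.assoc)
    show "integrable M (\<lambda>z. poly p (exp (- x) * exp (- z)))"
      unfolding * using integrable_exp_nonneg_law[OF M] by
          (intro Bochner_Integration.integrable_sum) auto
    show "(\<integral>z. poly p (exp (- x) * exp (- z)) \<partial>M) = (\<Sum>i\<le>degree p. coeff p i * laplace M i * exp
        (- real i * x))"
      unfolding *
      by (subst Bochner_Integration.integral_sum[OF integrable_mult_right[OF
          integrable_exp_nonneg_law[OF M of_nat_0_le_iff]]])
        (simp add: laplace_def mult_ac)
  qed
  have "poly_laplace (\<lambda>s. laplace N s * laplace M s) p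
      = (\<integral>x. (\<Sum>i\<le>degree p. coeff p i * laplace M i * exp (- real i * x)) \<partial>N)"
    by (subst Bochner_Integration.integral_sum[OF integrable_mult_right[OF
        integrable_exp_nonneg_law[OF N of_nat_0_le_iff]]])
      (simp add: poly_laplace_def laplace_def[of N] mult_ac)
  also have "\<dots> \<le> (\<integral>x. poly p (exp (- x)) \<partial>N)"
  proof (rule integral_mono_AE)
    show "integrable N (\<lambda>x. \<Sum>i\<le>degree p. coeff p i * laplace M i * exp (- real i * x))"
      using integrable_exp_nonneg_law[OF N] by (intro Bochner_Integration.integrable_sum) auto
    show "integrable N (\<lambda>x. poly p (exp (- x)))"
      using integrable_exp_nonneg_law[OF N]
      by (auto simp: poly_altdef exp_of_nat_mult[symmetric])
    show "AE x in N. (\<Sum>i\<le>degree p. coeff p i * laplace M i * exp (- real i * x)) \<le> poly p (exp (- x))"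
      using nonneg_lawD(4)[OF N]
    proof eventually_elim
      case (elim x)
      have "(\<integral>z. poly p (exp (- x) * exp (- z)) \<partial>M) \<le> (\<integral>z. poly p (exp (- x)) \<partial>M)"
      proof (rule integral_mono_AE[OF int(1)])
        show "AE z in M. poly p (exp (- x) * exp (- z)) \<le> poly p (exp (- x))"
          using nonneg_lawD(4)[OF M]
        proof eventually_elim
          fix z :: real assume z: "0 \<le> z"
          have le: "exp (- x) * exp (- z) \<le> exp (- x) * 1" using z by (intro mult_left_mono) auto
          show "poly p (exp (- x) * exp (- z)) \<le> poly p (exp (- x))"
          proof (rule DERIV_nonneg_imp_nondecreasing[where f="poly p" and b="exp (- x)"])
            fix y assume y: "exp (- x) * exp (- z) \<le> y" "y \<le> exp (- x)"
            then have "0 \<le> y" "y \<le> 1" using elim by (auto intro: order_trans[OF _ y(1)]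
                order_trans[OF y(2)])
            then show "\<exists>d. (poly p has_real_derivative d) (at y) \<and> 0 \<le> d"
              using p by (intro exI[of _ "poly (pderiv p) y"] conjI poly_DERIV) auto
          qed (use le in simp)
        qed
      qed auto
      then show ?case by (simp add: int(2) M.prob_space)
    qed
  qed
  finally show "poly_laplace (\<lambda>s. laplace N s * laplace M s) p \<le> poly_laplace (laplace N) p"
    by (simp add: poly_laplace_integral[OF N])
qed

text \<open>The required copy and its independent increment are the coordinates on the product of
  the first law with the law behind \<open>\<psi>\<close>. Their sum has the right distribution
  because a law is determined by its transform.\<close>

lemma conv_leI:
  assumes N1: "nonneg_law (distr M\<^sub>1 borel X\<^sub>1)" and N2: "nonneg_law (distr M\<^sub>2 borel X\<^sub>2)"
    and \<psi>: "laplace_prob \<psi>"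
    and e: "\<And>s. 0 \<le> s \<Longrightarrow> laplace (distr M\<^sub>2 borel X\<^sub>2) s = laplace (distr M\<^sub>1 borel X\<^sub>1) s * \<psi> s"
  shows "conv_le M\<^sub>1 X\<^sub>1 M\<^sub>2 X\<^sub>2"
proof -
  obtain \<nu> where \<nu>: "nonneg_law \<nu>" and L: "\<And>s. 0 \<le> s \<Longrightarrow> laplace \<nu> s = \<psi> s"
    using \<psi> unfolding laplace_prob_def by auto
  define A where "A = distr M\<^sub>1 borel X\<^sub>1"
  have A: "nonneg_law A" using N1 by (simp add: A_def)
  note [simp] = nonneg_lawD(3)[OF A] nonneg_lawD(3)[OF \<nu>]
  have [measurable_cong]: "sets A = sets borel" "sets \<nu> = sets borel"
    using nonneg_lawD(2)[OF A] nonneg_lawD(2)[OF \<nu>] by auto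
  interpret A: prob_space A using nonneg_lawD(1)[OF A] .
  interpret \<nu>: prob_space \<nu> using nonneg_lawD(1)[OF \<nu>] .
  interpret P: prob_space "A \<Otimes>\<^sub>M \<nu>"
    using A.prob_space_axioms \<nu>.prob_space_axioms by (rule prob_space_pair)
  have idA: "distr A borel (\<lambda>x. x) = A"
    using distr_id2[OF nonneg_lawD(2)[OF A, symmetric]] by simp
  \<comment> \<open>\<open>conv_le\<close> asks for an increment that is nonnegative everywhere,
    whereas the law is only almost surely nonnegative; truncation at 0 repairs this without changing
    the distribution.\<close>
  have max: "distr \<nu> borel (max 0) = \<nu>"
  proof -
    have "distr \<nu> borel (max 0) = distr \<nu> \<nu> (\<lambda>x. x)"
      by (rule distr_cong_AE) (use nonneg_lawD(4)[OF \<nu>] in \<open>auto simp: nonneg_lawD(2)[OF \<nu>]\<close>)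
    then show ?thesis by simp
  qed
  have joint: "distr (A \<Otimes>\<^sub>M \<nu>) (borel \<Otimes>\<^sub>M borel) (\<lambda>p. (fst p, max 0 (snd p))) = A \<Otimes>\<^sub>M \<nu>"
  proof -
    have "distr A borel (\<lambda>x. x) \<Otimes>\<^sub>M distr \<nu> borel (max 0)
        = distr (A \<Otimes>\<^sub>M \<nu>) (borel \<Otimes>\<^sub>M borel) (\<lambda>(x, y). (x, max 0 y))"
      by (rule pair_measure_distr) (auto simp: max \<nu>.sigma_finite_measure_axioms)
    then show ?thesis unfolding idA max split_beta' by (rule sym)
  qed
  have fst: "distr (A \<Otimes>\<^sub>M \<nu>) borel fst = A"
  proof -
    have "distr (A \<Otimes>\<^sub>M \<nu>) borel fst = distr (A \<Otimes>\<^sub>M \<nu>) A fst"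
      by (rule distr_cong) (auto simp: nonneg_lawD(2)[OF A])
    then show ?thesis by (simp add: \<nu>.distr_pair_fst)
  qed
  have snd: "distr (A \<Otimes>\<^sub>M \<nu>) borel (\<lambda>p. max 0 (snd p)) = \<nu>"
  proof -
    have "distr (A \<Otimes>\<^sub>M \<nu>) \<nu> snd = \<nu>"
    proof (rule measure_eqI)
      fix B assume "B \<in> sets (distr (A \<Otimes>\<^sub>M \<nu>) \<nu> snd)"
      then have B: "B \<in> sets \<nu>" by simp
      have "snd -` B \<inter> space (A \<Otimes>\<^sub>M \<nu>) = space A \<times> B" by (auto simp: space_pair_measure)
      moreover have "emeasure (A \<Otimes>\<^sub>M \<nu>) (space A \<times> B) = emeasure A (space A) * emeasure \<nu> B"
        using B by (intro \<nu>.emeasure_pair_measure_Times) auto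
      ultimately show "emeasure (distr (A \<Otimes>\<^sub>M \<nu>) \<nu> snd) B = emeasure \<nu> B"
        using B A.emeasure_space_1 by (simp add: emeasure_distr)
    qed simp
    then have "distr (distr (A \<Otimes>\<^sub>M \<nu>) \<nu> snd) borel (max 0) = \<nu>"
      by (simp add: max)
    then show ?thesis by (subst (asm) distr_distr) (auto simp: comp_def)
  qed
  have sum: "distr (A \<Otimes>\<^sub>M \<nu>) borel (\<lambda>p. fst p + max 0 (snd p)) = distr M\<^sub>2 borel X\<^sub>2"
  proof -
    have "distr (distr (A \<Otimes>\<^sub>M \<nu>) (borel \<Otimes>\<^sub>M borel) (\<lambda>p. (fst p, max 0 (snd p)))) borel (\<lambda>(x, y). x
        + y) = (A \<star> \<nu>)"
      unfolding joint convolution_def by simp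
    then have "distr (A \<Otimes>\<^sub>M \<nu>) borel (\<lambda>p. fst p + max 0 (snd p)) = (A \<star> \<nu>)"
      by (subst (asm) distr_distr) (auto simp: comp_def)
    also have "\<dots> = distr M\<^sub>2 borel X\<^sub>2"
      by (rule nonneg_law_eqI) (simp_all add: nonneg_law_convolution A \<nu> N2 e L A_def[symmetric])
    finally show ?thesis .
  qed
  show ?thesis
    unfolding conv_le_def
  proof (intro exI conjI)
    show "prob_space (A \<Otimes>\<^sub>M \<nu>)" by (rule P.prob_space_axioms)
    show "P.indep_var borel fst borel (\<lambda>p. max 0 (snd p))"
      unfolding P.indep_var_distribution_eq by (simp add: fst snd joint)
    show "\<forall>p\<in>space (A \<Otimes>\<^sub>M \<nu>). 0 \<le> max 0 (snd p)" by simp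
    show "distr (A \<Otimes>\<^sub>M \<nu>) borel fst = distr M\<^sub>1 borel X\<^sub>1"
      using fst by (simp add: A_def)
    show "distr M\<^sub>2 borel X\<^sub>2 = distr (A \<Otimes>\<^sub>M \<nu>) borel (\<lambda>p. fst p + max 0 (snd p))"
      by (simp add: sum)
  qed
qed

lemma st_leI:
  assumes N1: "nonneg_law (distr M\<^sub>1 borel X\<^sub>1)" and N2: "nonneg_law (distr M\<^sub>2 borel X\<^sub>2)"
    and X: "X\<^sub>1 \<in> borel_measurable M\<^sub>1" "X\<^sub>2 \<in> borel_measurable M\<^sub>2"
    and le: "laplace_st_le (laplace (distr M\<^sub>1 borel X\<^sub>1)) (laplace (distr M\<^sub>2 borel X\<^sub>2))"
  shows "st_le M\<^sub>1 X\<^sub>1 M\<^sub>2 X\<^sub>2"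
proof -
  have "measure (distr M borel X) {t..} = measure M {\<omega> \<in> space M. t \<le> X \<omega>}"
    if "X \<in> borel_measurable M" for M and X :: "'c \<Rightarrow> real" and t
    using that by (subst measure_distr) (auto intro!: arg_cong[where f="measure M"])
  from this[OF X(1)] this[OF X(2)] show ?thesis
    using laplace_st_le_atLeast[OF N1 N2 le] by (simp add: st_le_def)
qed

section \<open>Gamma laws\<close>

lemma gamma_density_nonneg: "0 < \<alpha> \<Longrightarrow> 0 \<le> gamma_density \<alpha> \<beta> t"
  by (simp add: gamma_density_def Gamma_real_pos)

lemma gamma_density_measurable[measurable]: "gamma_density \<alpha> \<beta> \<in> borel_measurable borel"
  unfolding gamma_density_def by measurable

lemma nn_integral_gamma_density:
  assumes "0 < \<alpha>" "0 < \<beta>"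
  shows "(\<integral>\<^sup>+t. ennreal (gamma_density \<alpha> \<beta> t) \<partial>lborel) = 1"
proof -
  have G: "0 < Gamma \<alpha>" using assms by (simp add: Gamma_real_pos)
  have "(\<integral>\<^sup>+t. ennreal (gamma_density \<alpha> \<beta> t) \<partial>lborel)
     = ennreal (1 / \<beta>) * (\<integral>\<^sup>+t. ennreal (gamma_density \<alpha> \<beta> (t / \<beta>)) \<partial>lborel)"
    using nn_integral_real_affine[of "\<lambda>t. ennreal (gamma_density \<alpha> \<beta> t)" "1/\<beta>" 0] assms by simp
  also have "\<dots> = (\<integral>\<^sup>+t. ennreal (1 / \<beta> * gamma_density \<alpha> \<beta> (t / \<beta>)) \<partial>lborel)"
    using assms by (subst nn_integral_cmult[symmetric])
      (auto simp: ennreal_mult'[symmetric] gamma_density_nonneg intro!: nn_integral_cong)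
  also have "\<dots> = (\<integral>\<^sup>+t. ennreal (1 / Gamma \<alpha>) * ennreal (indicator {0..} t * t powr
      (\<alpha> - 1) / exp t) \<partial>lborel)"
  proof (intro nn_integral_cong)
    fix t :: real
    have "1 / \<beta> * gamma_density \<alpha> \<beta> (t / \<beta>) = 1 / Gamma \<alpha> * (indicator {0..} t * t powr (\<alpha> - 1) / exp t)"
    proof (cases "t < 0")
      case True
      then show ?thesis using assms by (simp add: gamma_density_def divide_neg_pos)
    next
      case False
      then have "(t / \<beta>) powr (\<alpha> - 1) = t powr (\<alpha> - 1) * \<beta> / \<beta> powr \<alpha>"
        using assms by (simp add: powr_divide powr_diff)
      then show ?thesis using False assms
        by (simp add: gamma_density_def divide_less_0_iff exp_minus field_simps)
    qed
    then show "ennreal (1 / \<beta> * gamma_density \<alpha> \<beta> (t / \<beta>)) = ennreal (1 / Gamma \<alpha>) * ennreal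
        (indicator {0..} t * t powr (\<alpha> - 1) / exp t)"
      using G by (simp add: ennreal_mult'[symmetric])
  qed
  also have "\<dots> = ennreal (1 / Gamma \<alpha>) * ennreal (Gamma \<alpha>)"
    by (subst nn_integral_cmult) (auto simp: Gamma_conv_nn_integral_real[OF assms(1)])
  also have "\<dots> = 1" using G by (simp add: ennreal_mult'[symmetric])
  finally show ?thesis .
qed

text \<open>Exponential tilting of a gamma density only shifts its rate from \<beta> to \<beta> + s.
  The transform is therefore the ratio of the normalizing constants.\<close>

lemma gamma_density_exp:
  assumes "0 < \<beta>" "0 \<le> s"
  shows "gamma_density \<alpha> \<beta> t * exp (- s * t) = exp (\<alpha> * ln (\<beta> / (\<beta> + s))) * gamma_density \<alpha> (\<beta> + s) t"
proof -
  have "exp (\<alpha> * ln (\<beta> / (\<beta> + s))) = \<beta> powr \<alpha> / (\<beta> + s) powr \<alpha>"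
    using assms by (simp add: powr_def ln_div exp_diff algebra_simps)
  then show ?thesis using assms
    by (auto simp: gamma_density_def exp_add[symmetric] algebra_simps)
qed

definition gamma_law :: "real \<Rightarrow> real \<Rightarrow> real measure" where
  "gamma_law \<alpha> \<beta> = density lborel (\<lambda>t. ennreal (gamma_density \<alpha> \<beta> t))"

lemma nonneg_law_gamma:
  assumes "0 < \<alpha>" "0 < \<beta>"
  shows "nonneg_law (gamma_law \<alpha> \<beta>)"
  unfolding nonneg_law_def
proof (intro conjI)
  show "prob_space (gamma_law \<alpha> \<beta>)"
    by (intro prob_spaceI) (simp add: gamma_law_def emeasure_density nn_integral_gamma_density[OF assms])
  show "AE x in gamma_law \<alpha> \<beta>. 0 \<le> x"
    unfolding gamma_law_def by (subst AE_density) (auto simp: gamma_density_def)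
qed (simp add: gamma_law_def)

lemma laplace_gamma:
  assumes "0 < \<alpha>" "0 < \<beta>" "0 \<le> s"
  shows "laplace (gamma_law \<alpha> \<beta>) s = exp (\<alpha> * ln (\<beta> / (\<beta> + s)))"
proof (rule laplace_eqI[OF nonneg_law_gamma])
  have "(\<integral>\<^sup>+ x. ennreal (exp (- s * x)) \<partial>gamma_law \<alpha> \<beta>) = (\<integral>\<^sup>+ x. ennreal (gamma_density \<alpha> \<beta> x * exp
      (- s * x)) \<partial>lborel)"
    unfolding gamma_law_def
    by (subst nn_integral_density) (auto simp: ennreal_mult' gamma_density_nonneg[OF assms(1)])
  also have "\<dots> = (\<integral>\<^sup>+ x. ennreal (exp (\<alpha> * ln (\<beta> / (\<beta> + s)))) * ennreal (gamma_density \<alpha> (\<beta>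
      + s) x) \<partial>lborel)"
    by (simp only: gamma_density_exp[OF assms(2,3)]) (simp add: ennreal_mult')
  also have "\<dots> = ennreal (exp (\<alpha> * ln (\<beta> / (\<beta> + s))))"
    using assms by (subst nn_integral_cmult) (auto simp: nn_integral_gamma_density)
  finally show "(\<integral>\<^sup>+ x. ennreal (exp (- s * x)) \<partial>gamma_law \<alpha> \<beta>) = \<dots>" .
qed (use assms in auto)

text \<open>The logarithm of the transform of the gamma sum. Quotients of transforms become
  differences, and the formula makes sense for shapes of any sign.\<close>

definition gamma_exponent :: "nat \<Rightarrow> (nat \<Rightarrow> real) \<Rightarrow> (nat \<Rightarrow> real) \<Rightarrow> real \<Rightarrow> real" where
  "gamma_exponent n \<alpha> \<beta> s = (\<Sum>i<n. \<alpha> i * ln (\<beta> i / (\<beta> i + s)))"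

lemma laplace_prob_gamma_sum:
  assumes "\<And>i. i < n \<Longrightarrow> 0 \<le> \<alpha> i" "\<And>i. i < n \<Longrightarrow> 0 < \<beta> i"
  shows "laplace_prob (\<lambda>s. exp (gamma_exponent n \<alpha> \<beta> s))"
proof -
  have "laplace_prob (\<lambda>s. exp (\<alpha> i * ln (\<beta> i / (\<beta> i + s))))" if "i < n" for i
  proof (cases "\<alpha> i = 0")
    case True
    then show ?thesis by (simp add: laplace_prob_one)
  next
    case False
    with assms[OF that] have "0 < \<alpha> i" "0 < \<beta> i" by auto
    then show ?thesis unfolding laplace_prob_def using nonneg_law_gamma laplace_gamma by blast
  qed
  then have "laplace_prob (\<lambda>s. \<Prod>i<n. exp (\<alpha> i * ln (\<beta> i / (\<beta> i + s))))"
    by (intro laplace_prob_prod) auto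
  then show ?thesis by (simp add: gamma_exponent_def exp_sum)
qed

section \<open>Quotients of gamma transforms\<close>

text \<open>The quotient is the integral of exp(-tx) over t in [a,b]. Exchanging the integrals
  leaves the integral of 1/t.\<close>

lemma nn_integral_Frullani:
  fixes a b :: real
  assumes a: "0 < a" and ab: "a \<le> b"
  shows "(\<integral>\<^sup>+x. ennreal ((exp (- a * x) - exp (- b * x)) / x * indicator {0<..} x) \<partial>lborel)
      = ennreal (ln (b / a))"
proof -
  have "(\<integral>\<^sup>+x. ennreal ((exp (- a * x) - exp (- b * x)) / x * indicator {0<..} x) \<partial>lborel)
      = (\<integral>\<^sup>+x. \<integral>\<^sup>+t. ennreal (exp (- t * x)) * indicator {a..b} t * indicator {0..} x \<partial>lborel \<partial>lborel)"
  proof (rule nn_integral_cong_AE)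
    show "AE x in lborel. ennreal ((exp (- a * x) - exp (- b * x)) / x * indicator {0<..} x)
      = (\<integral>\<^sup>+t. ennreal (exp (- t * x)) * indicator {a..b} t * indicator {0..} x \<partial>lborel)"
      using AE_lborel_singleton[of "0::real"]
    proof eventually_elim
      case (elim x)
      show ?case
      proof (cases "0 < x")
        case True
        have "(\<integral>\<^sup>+t. ennreal (exp (- t * x)) * indicator {a..b} t \<partial>lborel)
            = ennreal (- exp (- b * x) / x - (- exp (- a * x) / x))"
        proof (rule nn_integral_FTC_Icc)
          show "((\<lambda>t. - exp (- t * x) / x) has_real_derivative exp (- t * x)) (at t)" for t
            using True by (auto intro!: derivative_eq_intros)
        qed (use ab in auto)
        also have "- exp (- b * x) / x - (- exp (- a * x) / x) = (exp (- a * x) - exp (- b * x)) / x"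
          by (simp add: diff_divide_distrib)
        finally show ?thesis using True by simp
      qed (use elim in auto)
    qed
  qed
  also have "\<dots> = (\<integral>\<^sup>+t. \<integral>\<^sup>+x. ennreal (exp (- t * x)) * indicator {a..b} t * indicator {0..} x
      \<partial>lborel \<partial>lborel)"
    by (rule lborel_pair.Fubini') measurable
  also have "\<dots> = (\<integral>\<^sup>+t. ennreal (1 / t) * indicator {a..b} t \<partial>lborel)"
  proof (rule nn_integral_cong)
    fix t :: real
    show "(\<integral>\<^sup>+x. ennreal (exp (- t * x)) * indicator {a..b} t * indicator {0..} x \<partial>lborel) = ennreal
        (1 / t) * indicator {a..b} t"
    proof (cases "t \<in> {a..b}")
      case True
      then have t: "0 < t" using a by auto
      have "filterlim (\<lambda>x. - t * x) at_bot at_top"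
        by (rule filterlim_tendsto_neg_mult_at_bot[OF tendsto_const _ filterlim_ident]) (use t in simp)
      then have "((\<lambda>x. - (exp (- t * x) / t)) \<longlongrightarrow> - (0 / t)) at_top"
        by (intro tendsto_intros filterlim_compose[OF exp_at_bot]) (use t in auto)
      then have "(\<integral>\<^sup>+x. ennreal (exp (- t * x)) * indicator {0..} x \<partial>lborel) = ennreal (- (0 / t) -
          (- (exp (- t * 0) / t)))"
        by (intro nn_integral_FTC_atLeast) (use t in \<open>auto intro!: derivative_eq_intros\<close>)
      then show ?thesis using True by simp
    qed simp
  qed
  also have "\<dots> = ennreal (ln b - ln a)"
    by (rule nn_integral_FTC_Icc) (use a ab in \<open>auto intro!: derivative_eq_intros simp: field_simps\<close>)
  finally show ?thesis using a ab by (simp add: ln_div)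
qed

text \<open>Both orders of a and b occur, since a rate may lie on either side of the reference rate
  1 used below.\<close>

lemma has_bochner_integral_Frullani:
  fixes a b :: real
  assumes a: "0 < a" and b: "0 < b"
  shows "has_bochner_integral lborel (\<lambda>x. (exp (- a * x) - exp (- b * x)) / x * indicator {0<..} x)
      (ln (b / a))"
proof -
  have *: "has_bochner_integral lborel (\<lambda>x. (exp (- a * x) - exp
      (- b * x)) / x * indicator {0<..} x) (ln (b / a))"
    if "0 < a" "a \<le> b" for a b :: real
  proof (rule has_bochner_integral_nn_integral)
    show "AE x in lborel. 0 \<le> (exp (- a * x) - exp (- b * x)) / x * indicator {0<..} x"
      using that by (auto intro!: AE_I2 divide_nonneg_pos mult_right_mono split: split_indicator)
  qed (use nn_integral_Frullani[OF that] that in auto)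
  show ?thesis
  proof (cases "a \<le> b")
    case False
    have "has_bochner_integral lborel (\<lambda>x. - ((exp (- b * x) - exp
        (- a * x)) / x * indicator {0<..} x)) (- ln (a / b))"
      using *[OF b] False by (intro has_bochner_integral_minus) auto
    also have "(\<lambda>x. - ((exp (- b * x) - exp (- a * x)) / x * indicator {0<..} x))
        = (\<lambda>x. (exp (- a * x) - exp (- b * x)) / x * indicator {0<..} x)"
      by (intro ext) (simp add: divide_inverse left_diff_distrib)
    also have "- ln (a / b) = ln (b / a)" using a b by (simp add: ln_div)
    finally show ?thesis .
  qed (use * a in auto)
qed

text \<open>The ratio of the two transforms is that of the compound Poisson law whose jumps have
  intensity \<open>(\<Sum>i<n. \<alpha>\<^sub>2 i * exp (- \<beta>\<^sub>2 i * x) - \<alpha>\<^sub>1 i * exp (- \<beta>\<^sub>1 i * x)) / x\<close>; equality of the total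
  shapes makes this intensity integrable at \<open>0\<close>.\<close>

lemma laplace_prob_gamma_ratio:
  assumes \<beta>: "\<And>i. i < n \<Longrightarrow> 0 < \<beta>\<^sub>1 i" "\<And>i. i < n \<Longrightarrow> 0 < \<beta>\<^sub>2 i"
    and tot: "(\<Sum>i<n. \<alpha>\<^sub>1 i) = (\<Sum>i<n. \<alpha>\<^sub>2 i)"
    and le: "\<And>x. 0 < x \<Longrightarrow> (\<Sum>i<n. \<alpha>\<^sub>1 i * exp (- \<beta>\<^sub>1 i * x)) \<le> (\<Sum>i<n. \<alpha>\<^sub>2 i * exp (- \<beta>\<^sub>2 i * x))"
  shows "laplace_prob (\<lambda>s. exp (gamma_exponent n \<alpha>\<^sub>2 \<beta>\<^sub>2 s - gamma_exponent n \<alpha>\<^sub>1 \<beta>\<^sub>1 s))"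
proof -
  define k where "k x = ((\<Sum>i<n. \<alpha>\<^sub>2 i * exp (- \<beta>\<^sub>2 i * x)) - (\<Sum>i<n. \<alpha>\<^sub>1 i * exp
      (- \<beta>\<^sub>1 i * x))) / x * indicator {0<..} x" for x :: real
  \<comment> \<open>\<open>J\<close> will be the transform of \<open>k\<close>. Every exponential is
    compared with exp(-x), so that Frullani's integral applies to each term; the reference terms of
    the two sums cancel because the total shapes agree.\<close>
  define J where "J s = (\<Sum>i<n. \<alpha>\<^sub>2 i * ln ((1 + s) / (\<beta>\<^sub>2 i + s))) - (\<Sum>i<n. \<alpha>\<^sub>1 i * ln ((1 + s) /
      (\<beta>\<^sub>1 i + s)))" for s
  have k_nonneg: "0 \<le> k x" for x
    using le by (auto simp: k_def split: split_indicator)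
  have [measurable]: "k \<in> borel_measurable borel" unfolding k_def by measurable
  have J: "has_bochner_integral lborel (\<lambda>x. exp (- s * x) * k x) (J s)" if s: "0 \<le> s" for s
  proof -
    let ?f = "\<lambda>\<beta> x. (exp (- (\<beta> + s) * x) - exp (- (1 + s) * x)) / x * indicator {0<..} x"
    have "has_bochner_integral lborel (\<lambda>x. (\<Sum>i<n. \<alpha>\<^sub>2 i * ?f (\<beta>\<^sub>2 i) x) - (\<Sum>i<n. \<alpha>\<^sub>1 i * ?f
        (\<beta>\<^sub>1 i) x)) (J s)"
      unfolding J_def
      by (intro has_bochner_integral_diff has_bochner_integral_sum has_bochner_integral_mult_right
          has_bochner_integral_Frullani)
        (use \<beta> s in \<open>auto simp: add_pos_nonneg\<close>)
    also have "(\<lambda>x. (\<Sum>i<n. \<alpha>\<^sub>2 i * ?f (\<beta>\<^sub>2 i) x) - (\<Sum>i<n. \<alpha>\<^sub>1 i * ?f (\<beta>\<^sub>1 i) x)) = (\<lambda>x. exp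
        (- s * x) * k x)"
    proof
      fix x :: real
      have *: "(\<Sum>i<n. \<alpha> i * ?f (\<beta> i) x) = exp (- s * x) * ((\<Sum>i<n. \<alpha> i * exp (- \<beta> i * x)) -
          (\<Sum>i<n. \<alpha> i) * exp (- x)) / x * indicator {0<..} x"
        for \<alpha> \<beta> :: "nat \<Rightarrow> real"
      proof -
        have "(\<Sum>i<n. \<alpha> i * ?f (\<beta> i) x) = (\<Sum>i<n. exp (- s * x) * (\<alpha> i * exp (- \<beta> i * x) - \<alpha> i * exp
            (- x)) / x * indicator {0<..} x)"
        proof (intro sum.cong refl)
          fix i
          have "exp (- (\<beta> i + s) * x) = exp (- s * x) * exp (- \<beta> i * x)" "exp (- (1 + s) * x) = exp
              (- s * x) * exp (- x)"
            by (simp_all add: exp_add[symmetric] algebra_simps)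
          then show "\<alpha> i * ?f (\<beta> i) x = exp (- s * x) * (\<alpha> i * exp (- \<beta> i * x) - \<alpha> i * exp
              (- x)) / x * indicator {0<..} x"
            by (simp only:) (simp add: divide_inverse algebra_simps)
        qed
        also have "\<dots> = exp (- s * x) * (\<Sum>i<n. \<alpha> i * exp (- \<beta> i * x) - \<alpha> i * exp
            (- x)) / x * indicator {0<..} x"
          by (simp only: sum_distrib_left sum_divide_distrib sum_distrib_right)
        finally show ?thesis by (simp only: sum_subtractf sum_distrib_right)
      qed
      show "(\<Sum>i<n. \<alpha>\<^sub>2 i * ?f (\<beta>\<^sub>2 i) x) - (\<Sum>i<n. \<alpha>\<^sub>1 i * ?f (\<beta>\<^sub>1 i) x) = exp (- s * x) * k x"
        unfolding * k_def by (simp add: tot divide_inverse algebra_simps)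
    qed
    finally show ?thesis .
  qed
  have ratio: "gamma_exponent n \<alpha>\<^sub>2 \<beta>\<^sub>2 s - gamma_exponent n \<alpha>\<^sub>1 \<beta>\<^sub>1 s = J s - J 0" if s: "0 \<le> s" for s
  proof -
    have *: "gamma_exponent n \<alpha> \<beta> s = (\<Sum>i<n. \<alpha> i * ln ((1 + s) / (\<beta> i + s))) - (\<Sum>i<n. \<alpha> i * ln ((1
        + 0) / (\<beta> i + 0))) - (\<Sum>i<n. \<alpha> i) * ln (1 + s)"
      if "\<And>i. i < n \<Longrightarrow> 0 < \<beta> i" for \<alpha> \<beta> :: "nat \<Rightarrow> real"
    proof -
      have "\<alpha> i * ln (\<beta> i / (\<beta> i + s)) = \<alpha> i * ln ((1 + s) / (\<beta> i + s)) - \<alpha> i * ln ((1 + 0) / (\<beta> i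
          + 0)) - \<alpha> i * ln (1 + s)"
        if "i < n" for i
        using \<open>\<And>i. i < n \<Longrightarrow> 0 < \<beta> i\<close>[OF that] s by (simp add: ln_div ln_inverse algebra_simps)
      then show ?thesis
        unfolding gamma_exponent_def sum_distrib_right sum_subtractf[symmetric] by (intro sum.cong) auto
    qed
    show ?thesis using *[where \<alpha>=\<alpha>\<^sub>1 and \<beta>=\<beta>\<^sub>1, OF \<beta>(1)] *[where \<alpha>=\<alpha>\<^sub>2 and \<beta>=\<beta>\<^sub>2, OF \<beta>(2)] unfolding
        J_def by (simp add: tot)
  qed
  have int_k: "has_bochner_integral lborel k (J 0)" using J[of 0] by simp
  have J0: "0 \<le> J 0" using has_bochner_integral_integral_eq[OF int_k] k_nonneg
      Bochner_Integration.integral_nonneg[of lborel k] by simp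
  show ?thesis
  proof (cases "J 0 = 0")
    \<comment> \<open>Total intensity 0 means that there are no jumps, and the quotient is
      constantly 1. The normalization below would divide by 0.\<close>
    case True
    have "AE x in lborel. k x = 0"
      using integral_nonneg_eq_0_iff_AE[of lborel k] int_k k_nonneg True by
          (auto simp: has_bochner_integral_iff)
    then have "AE x in lborel. exp (- s * x) * k x = 0" for s by eventually_elim simp
    then have "(\<integral>x. exp (- s * x) * k x \<partial>lborel) = 0" for s by (rule integral_eq_zero_AE)
    then have "J s = 0" if "0 \<le> s" for s
      using J[OF that] by (metis has_bochner_integral_integral_eq)
    then show ?thesis by (intro laplace_prob_cong[OF laplace_prob_one]) (simp add: ratio)
  next
    case False
    with J0 have J0: "0 < J 0" by simp
    \<comment> \<open>The jump law is the intensity divided by its mass \<open>J 0\<close>, and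
      \<open>J 0\<close> is the Poisson mean: J s - J 0 = J 0 * (J s / J 0 - 1).\<close>
    define N where "N = density lborel (\<lambda>x. ennreal (k x / J 0))"
    have nn: "(\<integral>\<^sup>+x. ennreal (exp (- s * x)) \<partial>N) = ennreal (J s / J 0)" if "0 \<le> s" for s
    proof -
      have "(\<integral>\<^sup>+x. ennreal (exp (- s * x)) \<partial>N) = (\<integral>\<^sup>+x. ennreal (exp (- s * x) * k x / J 0) \<partial>lborel)"
        unfolding N_def using J0 k_nonneg
        by (subst nn_integral_density) (auto simp: ennreal_mult''[symmetric] mult.commute)
      also have "\<dots> = ennreal (J s / J 0)"
        using has_bochner_integral_divide[OF J[OF that], of "J 0"] J0 k_nonneg
        by (subst nn_integral_eq_integral) (auto simp: has_bochner_integral_iff)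
      finally show ?thesis .
    qed
    have N: "nonneg_law N"
      unfolding nonneg_law_def
    proof (intro conjI)
      have "(\<integral>\<^sup>+x. 1 \<partial>N) = 1" using nn[of 0] J0 by simp
      then show "prob_space N" by (intro prob_spaceI) simp
      show "AE x in N. 0 \<le> x" unfolding N_def by (subst AE_density)
          (auto simp: k_def not_less intro!: AE_I2 split: split_indicator)
    qed (simp add: N_def)
    have Js: "0 \<le> J s" if "0 \<le> s" for s
      using has_bochner_integral_integral_eq[OF J[OF that]]
        Bochner_Integration.integral_nonneg[of lborel "\<lambda>x. exp (- s * x) * k x"] k_nonneg by simp
    have "laplace_prob (\<lambda>s. J s / J 0)"
      unfolding laplace_prob_def
      by (intro exI[of _ N] conjI N allI impI laplace_eqI[OF N] nn) (use Js J0 in auto)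
    from laplace_prob_compound_Poisson[OF this J0] show ?thesis
      by (rule laplace_prob_cong) (use J0 in \<open>simp add: ratio algebra_simps\<close>)
  qed
qed

lemma gamma_sum_law:
  fixes \<alpha> \<beta> :: "nat \<Rightarrow> real"
  assumes M: "prob_space M" and indep: "prob_space.indep_vars M (\<lambda>_. borel) X {..<n}"
    and D: "\<And>i. i < n \<Longrightarrow> distributed M lborel (X i) (\<lambda>t. ennreal (gamma_density (\<alpha> i) (\<beta> i) t))"
    and pos: "\<And>i. i < n \<Longrightarrow> 0 < \<alpha> i" "\<And>i. i < n \<Longrightarrow> 0 < \<beta> i"
  shows "nonneg_law (distr M borel (\<lambda>\<omega>. \<Sum>i<n. X i \<omega>))"
    and "0 \<le> s \<Longrightarrow> laplace (distr M borel (\<lambda>\<omega>. \<Sum>i<n. X i \<omega>)) s = exp (gamma_exponent n \<alpha> \<beta> s)"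
    and "(\<lambda>\<omega>. \<Sum>i<n. X i \<omega>) \<in> borel_measurable M"
proof -
  interpret prob_space M by fact
  have X[measurable]: "i < n \<Longrightarrow> X i \<in> borel_measurable M" for i
    using distributed_measurable[OF D] by simp
  show S[measurable]: "(\<lambda>\<omega>. \<Sum>i<n. X i \<omega>) \<in> borel_measurable M"
    by (intro borel_measurable_sum) auto
  have law: "distr M lborel (X i) = gamma_law (\<alpha> i) (\<beta> i)" if "i < n" for i
    using distributed_distr_eq_density[OF D[OF that]] by (simp add: gamma_law_def)
  have "AE \<omega> in M. 0 \<le> X i \<omega>" if "i < n" for i
  proof -
    have "AE x in distr M lborel (X i). 0 \<le> x"
      unfolding law[OF that] by (rule nonneg_lawD(4)[OF nonneg_law_gamma[OF pos[OF that]]])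
    then show ?thesis by (subst (asm) AE_distr_iff) (auto simp: that)
  qed
  then have "AE \<omega> in M. \<forall>i\<in>{..<n}. 0 \<le> X i \<omega>" by (intro AE_finite_allI) auto
  then have "AE \<omega> in M. 0 \<le> (\<Sum>i<n. X i \<omega>)" by eventually_elim (auto intro: sum_nonneg)
  then show 1: "nonneg_law (distr M borel (\<lambda>\<omega>. \<Sum>i<n. X i \<omega>))"
    unfolding nonneg_law_def by (auto simp: AE_distr_iff prob_space_distr)
  show "laplace (distr M borel (\<lambda>\<omega>. \<Sum>i<n. X i \<omega>)) s = exp (gamma_exponent n \<alpha> \<beta> s)" if s: "0 \<le> s"
  proof (rule laplace_eqI[OF 1])
    have "(\<integral>\<^sup>+x. ennreal (exp (- s * x)) \<partial>distr M borel (\<lambda>\<omega>. \<Sum>i<n. X i \<omega>))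
        = (\<integral>\<^sup>+\<omega>. (\<Prod>i<n. ennreal (exp (- s * X i \<omega>))) \<partial>M)"
      by (subst nn_integral_distr) (auto simp: prod_ennreal exp_sum[symmetric] sum_distrib_left sum_negf)
    also have "\<dots> = (\<Prod>i<n. \<integral>\<^sup>+\<omega>. ennreal (exp (- s * X i \<omega>)) \<partial>M)"
      by (intro indep_vars_nn_integral indep_vars_compose2[OF indep]) auto
    also have "\<dots> = (\<Prod>i<n. ennreal (exp (\<alpha> i * ln (\<beta> i / (\<beta> i + s)))))"
    proof (intro prod.cong refl)
      fix i assume "i \<in> {..<n}"
      then have i: "i < n" by simp
      have "(\<integral>\<^sup>+\<omega>. ennreal (exp (- s * X i \<omega>)) \<partial>M) = (\<integral>\<^sup>+x. ennreal (exp (- s * x)) \<partial>distr M lborel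
          (X i))"
        using i by (subst nn_integral_distr) auto
      also have "\<dots> = ennreal (exp (\<alpha> i * ln (\<beta> i / (\<beta> i + s))))"
        by (simp only: law[OF i] nn_laplace[OF nonneg_law_gamma[OF pos[OF i]] s] laplace_gamma[OF
            pos[OF i] s])
      finally show "(\<integral>\<^sup>+\<omega>. ennreal (exp (- s * X i \<omega>)) \<partial>M) = \<dots>" .
    qed
    also have "\<dots> = ennreal (exp (gamma_exponent n \<alpha> \<beta> s))"
      by (simp add: prod_ennreal gamma_exponent_def exp_sum)
    finally show "(\<integral>\<^sup>+x. ennreal (exp (- s * x)) \<partial>distr M borel (\<lambda>\<omega>. \<Sum>i<n. X i \<omega>)) = \<dots>" .
  qed simp
qed

section \<open>Segments of log-rates\<close>

text \<open>The operator y d/dy multiplies the i-th coefficient by i. Along a segment of log-rates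
  the derivative of the transform at a natural number m carries a factor m, and this identity turns
  these factors into the derivative of the test polynomial.\<close>

lemma sum_coeff_pderiv:
  fixes p :: "real poly"
  shows "(\<Sum>i\<le>degree p. coeff p i * real i * y ^ i) = y * poly (pderiv p) y"
proof -
  have "((\<lambda>y. \<Sum>i\<le>degree p. coeff p i * y ^ i) has_real_derivative (\<Sum>i\<le>degree p. coeff p i *
      (real i * y ^ (i - 1)))) (at y)"
    by (auto intro!: derivative_eq_intros simp: mult_ac)
  moreover have "((\<lambda>y. \<Sum>i\<le>degree p. coeff p i * y ^ i) has_real_derivative poly (pderiv p) y) (at y)"
    using poly_DERIV[of p y] by (simp add: poly_altdef[abs_def])
  ultimately have "poly (pderiv p) y = (\<Sum>i\<le>degree p. coeff p i * (real i * y ^ (i - 1)))"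
    by (blast intro: DERIV_unique)
  then have "y * poly (pderiv p) y = (\<Sum>i\<le>degree p. y * (coeff p i * (real i * y ^ (i - 1))))"
    by (simp add: sum_distrib_left)
  also have "\<dots> = (\<Sum>i\<le>degree p. coeff p i * real i * y ^ i)"
  proof (intro sum.cong refl)
    fix i show "y * (coeff p i * (real i * y ^ (i - 1))) = coeff p i * real i * y ^ i"
      by (cases i) auto
  qed
  finally show ?thesis ..
qed

lemma has_bochner_integral_exp_atLeast:
  fixes r :: real
  assumes "0 < r"
  shows "has_bochner_integral lborel (\<lambda>x. exp (- r * x) * indicator {0..} x) (1 / r)"
proof (rule has_bochner_integral_nn_integral)
  have "filterlim (\<lambda>x. - r * x) at_bot at_top"
    by (rule filterlim_tendsto_neg_mult_at_bot[OF tendsto_const _ filterlim_ident]) (use assms in simp)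
  then have "((\<lambda>x. - (exp (- r * x) / r)) \<longlongrightarrow> - (0 / r)) at_top"
    by (intro tendsto_intros filterlim_compose[OF exp_at_bot]) (use assms in auto)
  then have "(\<integral>\<^sup>+x. ennreal (exp (- r * x)) * indicator {0..} x \<partial>lborel) = ennreal (- (0 / r) - (-
      (exp (- r * 0) / r)))"
    by (intro nn_integral_FTC_atLeast) (use assms in \<open>auto intro!: derivative_eq_intros\<close>)
  then show "(\<integral>\<^sup>+x. ennreal (exp (- r * x) * indicator {0..} x) \<partial>lborel) = ennreal (1 / r)"
    by (simp add: ennreal_mult'' ennreal_indicator)
qed (use assms in auto)

text \<open>Along the segment the \<open>\<tau>\<close>-derivative of the transform \<open>L\<close> at \<open>s\<close> is \<open>- s * \<kappa> s * L s\<close>, where \<open>\<kappa>\<close> is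
  the transform of the nonnegative function \<open>\<lambda>x. - (\<Sum>i<n. \<alpha> i * (c i - b i) * exp (- r \<tau> i * x))\<close>. As
  \<open>(1 - L s) / s\<close> is the transform of the tail, the tail grows at the rate whose transform is
  \<open>\<kappa> s * L s\<close>, hence nonnegative.\<close>

lemma laplace_st_le_log_segment:
  fixes \<alpha> b c :: "nat \<Rightarrow> real"
  defines "r \<equiv> \<lambda>\<tau> i. exp ((1 - \<tau>) * b i + \<tau> * c i)"
  assumes \<alpha>: "\<And>i. i < n \<Longrightarrow> 0 \<le> \<alpha> i"
    and K: "\<And>\<tau> x. 0 \<le> \<tau> \<Longrightarrow> \<tau> \<le> 1 \<Longrightarrow> 0 \<le> x \<Longrightarrow> (\<Sum>i<n. \<alpha> i * (c i - b i) * exp (- r \<tau> i * x)) \<le> 0"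
  shows "laplace_st_le (\<lambda>s. exp (gamma_exponent n \<alpha> (\<lambda>i. exp (b i)) s))
    (\<lambda>s. exp (gamma_exponent n \<alpha> (\<lambda>i. exp (c i)) s))"
  unfolding laplace_st_le_def
proof (intro allI impI)
  fix p :: "real poly" assume p: "\<forall>y\<in>{0..1}. 0 \<le> poly (pderiv p) y"
  define L where "L \<tau> s = exp (gamma_exponent n \<alpha> (r \<tau>) s)" for \<tau> s
  define \<kappa> where "\<kappa> \<tau> s = - (\<Sum>i<n. \<alpha> i * (c i - b i) / (r \<tau> i + s))" for \<tau> s
  have r_pos: "0 < r \<tau> i" for \<tau> i by (simp add: r_def)
  have dlog: "((\<lambda>\<tau>. ln (r \<tau> i / (r \<tau> i + s))) has_real_derivative (c i - b i) * s / (r \<tau> i + s)) (at \<tau>)"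
    if s: "0 \<le> s" for i s \<tau>
  proof -
    \<comment> \<open>The logarithm of the rate is affine in \<tau>. This is what leaves a factor s
      in the derivative: (c - b) - r (c - b) / (r + s) = (c - b) s / (r + s).\<close>
    have lin: "((\<lambda>\<tau>. (1 - \<tau>) * b i + \<tau> * c i) has_real_derivative (c i - b i)) (at \<tau>)"
      by (auto intro!: derivative_eq_intros)
    have "((\<lambda>\<tau>. r \<tau> i) has_real_derivative r \<tau> i * (c i - b i)) (at \<tau>)"
      unfolding r_def by (rule DERIV_fun_exp[OF lin])
    then have "((\<lambda>\<tau>. ln (r \<tau> i + s)) has_real_derivative r \<tau> i * (c i - b i) / (r \<tau> i + s)) (at \<tau>)"
      using add_pos_nonneg[OF r_pos[of \<tau> i] s] by (auto intro!: derivative_eq_intros)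
    from DERIV_diff[OF lin this]
    have "((\<lambda>\<tau>. (1 - \<tau>) * b i + \<tau> * c i - ln (r \<tau> i + s)) has_real_derivative
        (c i - b i) - r \<tau> i * (c i - b i) / (r \<tau> i + s)) (at \<tau>)" .
    also have "(\<lambda>\<tau>. (1 - \<tau>) * b i + \<tau> * c i - ln (r \<tau> i + s)) = (\<lambda>\<tau>. ln (r \<tau> i / (r \<tau> i + s)))"
    proof
      fix \<tau>
      have "0 < r \<tau> i + s" using r_pos[of \<tau> i] s by simp
      then show "(1 - \<tau>) * b i + \<tau> * c i - ln (r \<tau> i + s) = ln (r \<tau> i / (r \<tau> i + s))"
        using r_pos[of \<tau> i] by (simp add: ln_div) (simp add: r_def)
    qed
    also have "(c i - b i) - r \<tau> i * (c i - b i) / (r \<tau> i + s) = (c i - b i) * s / (r \<tau> i + s)"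
      using r_pos[of \<tau> i] s by (simp add: field_simps)
    finally show ?thesis .
  qed
  have dL: "((\<lambda>\<tau>. L \<tau> s) has_real_derivative (- s * \<kappa> \<tau> s * L \<tau> s)) (at \<tau>)" if "0 \<le> s" for s \<tau>
  proof -
    have "((\<lambda>\<tau>. L \<tau> s) has_real_derivative L \<tau> s * (\<Sum>i<n. \<alpha> i * ((c i - b i) * s / (r \<tau> i + s)))) (at \<tau>)"
      unfolding L_def gamma_exponent_def
      by (intro DERIV_fun_exp DERIV_sum DERIV_cmult dlog that)
    also have "L \<tau> s * (\<Sum>i<n. \<alpha> i * ((c i - b i) * s / (r \<tau> i + s))) = - s * \<kappa> \<tau> s * L \<tau> s"
      by (simp add: \<kappa>_def sum_distrib_left sum_distrib_right sum_negf mult_ac)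
    finally show ?thesis .
  qed
  have deriv: "((\<lambda>\<tau>. poly_laplace (L \<tau>) p) has_real_derivative
      (\<Sum>m\<le>degree p. coeff p m * (- real m * \<kappa> \<tau> (real m) * L \<tau> (real m)))) (at \<tau>)" for \<tau>
    unfolding poly_laplace_def by (intro DERIV_sum DERIV_cmult dL) auto
  have nonpos: "(\<Sum>m\<le>degree p. coeff p m * (- real m * \<kappa> \<tau> (real m) * L \<tau> (real m))) \<le> 0"
    if \<tau>: "0 \<le> \<tau>" "\<tau> \<le> 1" for \<tau>
  proof -
    obtain N where N: "nonneg_law N" and LN: "\<And>s. 0 \<le> s \<Longrightarrow> laplace N s = L \<tau> s"
      using laplace_prob_gamma_sum[of n \<alpha> "r \<tau>"] \<alpha> r_pos unfolding laplace_prob_def L_def by auto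
    \<comment> \<open>Integrating \<open>h\<close> against the law with transform
      \<open>L \<tau>\<close> yields minus the derivative sought. Writing each
      \<open>\<kappa>\<close> as an integral over x turns \<open>h t\<close> into the integral of
      k(x) times y p'(y) with y = exp(-(t + x)), which lies in [0,1].\<close>
    define h where "h t = (\<Sum>m\<le>degree p. coeff p m * real m * \<kappa> \<tau> (real m) * exp (- real m * t))" for t
    have "0 \<le> h t" if t: "0 \<le> t" for t
    proof -
      define k where "k x = - (\<Sum>i<n. \<alpha> i * (c i - b i) * exp (- r \<tau> i * x))" for x
      have \<kappa>: "has_bochner_integral lborel (\<lambda>x. exp (- real m * x) * k x * indicator {0..} x) (\<kappa> \<tau>
          (real m))" for m :: nat
      proof -
        have "has_bochner_integral lborel (\<lambda>x. - (\<Sum>i<n. \<alpha> i * (c i - b i) * (exp (- (r \<tau> i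
            + real m) * x) * indicator {0..} x)))
            (- (\<Sum>i<n. \<alpha> i * (c i - b i) * (1 / (r \<tau> i + real m))))"
          by (intro has_bochner_integral_minus has_bochner_integral_sum has_bochner_integral_mult_right
              has_bochner_integral_exp_atLeast add_pos_nonneg r_pos) auto
        also have "(\<lambda>x. - (\<Sum>i<n. \<alpha> i * (c i - b i) * (exp (- (r \<tau> i + real m) * x) * indicator {0..} x)))
            = (\<lambda>x. exp (- real m * x) * k x * indicator {0..} x)"
        proof
          fix x :: real
          have "exp (- (r \<tau> i + real m) * x) = exp (- real m * x) * exp (- r \<tau> i * x)" for i
            by (simp add: exp_add[symmetric] algebra_simps)
          then show "- (\<Sum>i<n. \<alpha> i * (c i - b i) * (exp (- (r \<tau> i + real m) * x) * indicator {0..} x))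
            = exp (- real m * x) * k x * indicator {0..} x"
            by (simp only: k_def) (simp add: sum_distrib_left sum_distrib_right mult_ac)
        qed
        finally show ?thesis by (simp add: \<kappa>_def)
      qed
      have int: "has_bochner_integral lborel
          (\<lambda>x. \<Sum>m\<le>degree p. coeff p m * real m * exp (- real m * t) * (exp
              (- real m * x) * k x * indicator {0..} x))
          (\<Sum>m\<le>degree p. coeff p m * real m * exp (- real m * t) * \<kappa> \<tau> (real m))"
        by (intro has_bochner_integral_sum has_bochner_integral_mult_right \<kappa>)
      have h: "(\<Sum>m\<le>degree p. coeff p m * real m * exp (- real m * t) * \<kappa> \<tau> (real m)) = h t"
        by (simp add: h_def mult_ac)
      have nonneg: "0 \<le> (\<Sum>m\<le>degree p. coeff p m * real m * exp (- real m * t) * (exp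
          (- real m * x) * k x * indicator {0..} x))" for x
      proof (cases "0 \<le> x")
        case True
        define y where "y = exp (- (t + x))"
        have y: "y \<in> {0..1}" using t True by (simp add: y_def)
        have "exp (- real m * t) * exp (- real m * x) = y ^ m" for m
          by (simp add: y_def exp_of_nat_mult[symmetric] exp_add[symmetric] algebra_simps)
        then have "(\<Sum>m\<le>degree p. coeff p m * real m * exp (- real m * t) * (exp
            (- real m * x) * k x * indicator {0..} x))
            = (\<Sum>m\<le>degree p. coeff p m * real m * y ^ m) * k x"
          using True by (simp add: sum_distrib_right mult.assoc[symmetric]) (simp add: mult.assoc)
        moreover have "0 \<le> k x" using K[OF \<tau> True] by (simp add: k_def)
        ultimately show ?thesis using p y by (simp add: sum_coeff_pderiv)
      qed simp
      show ?thesis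
        unfolding h[symmetric] has_bochner_integral_integral_eq[OF int, symmetric]
        by (rule Bochner_Integration.integral_nonneg) (rule nonneg)
    qed
    then have "0 \<le> (\<integral>t. h t \<partial>N)"
      using nonneg_lawD(4)[OF N] by (intro integral_nonneg_AE) auto
    also have "(\<integral>t. h t \<partial>N) = (\<Sum>m\<le>degree p. coeff p m * real m * \<kappa> \<tau> (real m) * laplace N (real m))"
      unfolding h_def
      by (subst Bochner_Integration.integral_sum[OF integrable_mult_right[OF
          integrable_exp_nonneg_law[OF N of_nat_0_le_iff]]])
        (simp add: laplace_def)
    also have "\<dots> = - (\<Sum>m\<le>degree p. coeff p m * (- real m * \<kappa> \<tau> (real m) * L \<tau> (real m)))"
      by (simp add: LN sum_negf[symmetric] mult_ac)
    finally show ?thesis by simp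
  qed
  have "poly_laplace (L 1) p \<le> poly_laplace (L 0) p"
    by (rule DERIV_nonpos_imp_nonincreasing[of 0 1 "\<lambda>\<tau>. poly_laplace (L \<tau>) p"])
        (use deriv nonpos in auto)
  then show "poly_laplace (\<lambda>s. exp (gamma_exponent n \<alpha> (\<lambda>i. exp (c i)) s)) p
      \<le> poly_laplace (\<lambda>s. exp (gamma_exponent n \<alpha> (\<lambda>i. exp (b i)) s)) p"
    by (simp add: L_def[abs_def] r_def)
qed

section \<open>Comparison of shape and rate vectors\<close>

text \<open>Only the quotient of transforms is mentioned: transitivity becomes multiplication, and
  intermediate vectors require no random variables.\<close>

definition gamma_conv_le ::
  "nat \<Rightarrow> (nat \<Rightarrow> real) \<Rightarrow> (nat \<Rightarrow> real) \<Rightarrow> (nat \<Rightarrow> real) \<Rightarrow> (nat \<Rightarrow> real) \<Rightarrow> bool" where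
  "gamma_conv_le n \<alpha>\<^sub>1 \<beta>\<^sub>1 \<alpha>\<^sub>2 \<beta>\<^sub>2 \<longleftrightarrow>
     laplace_prob (\<lambda>s. exp (gamma_exponent n \<alpha>\<^sub>2 \<beta>\<^sub>2 s - gamma_exponent n \<alpha>\<^sub>1 \<beta>\<^sub>1 s))"

definition gamma_st_le ::
  "nat \<Rightarrow> (nat \<Rightarrow> real) \<Rightarrow> (nat \<Rightarrow> real) \<Rightarrow> (nat \<Rightarrow> real) \<Rightarrow> (nat \<Rightarrow> real) \<Rightarrow> bool" where
  "gamma_st_le n \<alpha>\<^sub>1 \<beta>\<^sub>1 \<alpha>\<^sub>2 \<beta>\<^sub>2 \<longleftrightarrow>
     laplace_st_le (\<lambda>s. exp (gamma_exponent n \<alpha>\<^sub>1 \<beta>\<^sub>1 s)) (\<lambda>s. exp (gamma_exponent n \<alpha>\<^sub>2 \<beta>\<^sub>2 s))"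

lemma gamma_conv_le_same:
  assumes "gamma_exponent n \<alpha>\<^sub>1 \<beta>\<^sub>1 = gamma_exponent n \<alpha>\<^sub>2 \<beta>\<^sub>2"
  shows "gamma_conv_le n \<alpha>\<^sub>1 \<beta>\<^sub>1 \<alpha>\<^sub>2 \<beta>\<^sub>2"
  using assms by (simp add: gamma_conv_le_def laplace_prob_one)

lemma gamma_conv_le_trans:
  assumes "gamma_conv_le n \<alpha>\<^sub>1 \<beta>\<^sub>1 \<alpha>\<^sub>2 \<beta>\<^sub>2" "gamma_conv_le n \<alpha>\<^sub>2 \<beta>\<^sub>2 \<alpha>\<^sub>3 \<beta>\<^sub>3"
  shows "gamma_conv_le n \<alpha>\<^sub>1 \<beta>\<^sub>1 \<alpha>\<^sub>3 \<beta>\<^sub>3"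
  using laplace_prob_mult[OF assms[unfolded gamma_conv_le_def]]
  by (simp add: gamma_conv_le_def exp_add[symmetric])

lemma gamma_st_le_trans:
  assumes "gamma_st_le n \<alpha>\<^sub>1 \<beta>\<^sub>1 \<alpha>\<^sub>2 \<beta>\<^sub>2" "gamma_st_le n \<alpha>\<^sub>2 \<beta>\<^sub>2 \<alpha>\<^sub>3 \<beta>\<^sub>3"
  shows "gamma_st_le n \<alpha>\<^sub>1 \<beta>\<^sub>1 \<alpha>\<^sub>3 \<beta>\<^sub>3"
  using assms unfolding gamma_st_le_def laplace_st_le_def by (meson order_trans)

text \<open>The quotient is the transform of a nonnegative increment, and adding such an increment
  raises every tail. The sign conditions make the first factor the transform of a law.\<close>

lemma gamma_conv_imp_st_le:
  assumes le: "gamma_conv_le n \<alpha>\<^sub>1 \<beta>\<^sub>1 \<alpha>\<^sub>2 \<beta>\<^sub>2"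
    and pos: "\<And>i. i < n \<Longrightarrow> 0 \<le> \<alpha>\<^sub>1 i" "\<And>i. i < n \<Longrightarrow> 0 < \<beta>\<^sub>1 i"
  shows "gamma_st_le n \<alpha>\<^sub>1 \<beta>\<^sub>1 \<alpha>\<^sub>2 \<beta>\<^sub>2"
proof -
  obtain N where N: "nonneg_law N" "\<And>s. 0 \<le> s \<Longrightarrow> laplace N s = exp (gamma_exponent n \<alpha>\<^sub>1 \<beta>\<^sub>1 s)"
    using laplace_prob_gamma_sum[of n \<alpha>\<^sub>1 \<beta>\<^sub>1] pos unfolding laplace_prob_def by auto
  obtain M where M: "nonneg_law M"
    "\<And>s. 0 \<le> s \<Longrightarrow> laplace M s = exp (gamma_exponent n \<alpha>\<^sub>2 \<beta>\<^sub>2 s - gamma_exponent n \<alpha>\<^sub>1 \<beta>\<^sub>1 s)"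
    using le unfolding gamma_conv_le_def laplace_prob_def by auto
  show ?thesis
    using laplace_st_le_mult[OF N(1) M(1)]
    by (simp add: gamma_st_le_def laplace_st_le_def poly_laplace_def N M exp_add[symmetric])
qed

section \<open>Elementary moves of shapes and rates\<close>

lemma gamma_conv_le_raise_shapes:
  assumes "\<And>i. i < n \<Longrightarrow> \<alpha>\<^sub>1 i \<le> \<alpha>\<^sub>2 i" "\<And>i. i < n \<Longrightarrow> 0 < \<beta> i"
  shows "gamma_conv_le n \<alpha>\<^sub>1 \<beta> \<alpha>\<^sub>2 \<beta>"
  using laplace_prob_gamma_sum[of n "\<lambda>i. \<alpha>\<^sub>2 i - \<alpha>\<^sub>1 i" \<beta>] assms
  by (simp add: gamma_conv_le_def gamma_exponent_def left_diff_distrib sum_subtractf)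

lemma gamma_conv_leI:
  assumes "\<And>i. i < n \<Longrightarrow> 0 < \<beta>\<^sub>1 i" "\<And>i. i < n \<Longrightarrow> 0 < \<beta>\<^sub>2 i"
    and "(\<Sum>i<n. \<alpha>\<^sub>1 i) = (\<Sum>i<n. \<alpha>\<^sub>2 i)"
    and "\<And>x. 0 < x \<Longrightarrow> (\<Sum>i<n. \<alpha>\<^sub>1 i * exp (- \<beta>\<^sub>1 i * x)) \<le> (\<Sum>i<n. \<alpha>\<^sub>2 i * exp (- \<beta>\<^sub>2 i * x))"
  shows "gamma_conv_le n \<alpha>\<^sub>1 \<beta>\<^sub>1 \<alpha>\<^sub>2 \<beta>\<^sub>2"
  unfolding gamma_conv_le_def using assms by (rule laplace_prob_gamma_ratio)

lemma gamma_conv_le_lower_rates: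
  assumes "\<And>i. i < n \<Longrightarrow> 0 \<le> \<alpha> i" "\<And>i. i < n \<Longrightarrow> 0 < \<beta>\<^sub>2 i" "\<And>i. i < n \<Longrightarrow> \<beta>\<^sub>2 i \<le> \<beta>\<^sub>1 i"
  shows "gamma_conv_le n \<alpha> \<beta>\<^sub>1 \<alpha> \<beta>\<^sub>2"
proof (rule gamma_conv_leI)
  show "0 < \<beta>\<^sub>1 i" if "i < n" for i using assms(2,3)[OF that] by simp
qed (use assms in \<open>auto intro!: sum_mono mult_left_mono\<close>)

lemma sum_mono_pair:
  fixes f g :: "nat \<Rightarrow> real"
  assumes "i < n" "j < n" "i \<noteq> j" "\<And>m. m < n \<Longrightarrow> m \<noteq> i \<Longrightarrow> m \<noteq> j \<Longrightarrow> f m = g m"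
    and "f i + f j \<le> g i + g j"
  shows "(\<Sum>m<n. f m) \<le> (\<Sum>m<n. g m)"
proof -
  have *: "(\<Sum>m<n. h m) = h i + h j + (\<Sum>m\<in>{..<n} - {i} - {j}. h m)" for h :: "nat \<Rightarrow> real"
    using assms(1-3) by (simp add: sum.remove[of "{..<n}" i] sum.remove[of "{..<n} - {i}" j])
  have "(\<Sum>m\<in>{..<n} - {i} - {j}. f m) = (\<Sum>m\<in>{..<n} - {i} - {j}. g m)"
    using assms(4) by (intro sum.cong) auto
  then show ?thesis using assms(5) by (simp add: *)
qed

text \<open>Moving shape from i to j, where the rate is smaller, replaces exp(-\<beta> i x) by the
  larger exp(-\<beta> j x). Only an inequality between the pair totals is assumed, because
  truncating shapes at 0 may increase the total.\<close>

lemma gamma_conv_le_spread_shapes: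
  assumes ij: "i < n" "j < n" "i \<noteq> j" and \<beta>: "\<And>m. m < n \<Longrightarrow> 0 < \<beta> m"
    and eq: "\<And>m. m < n \<Longrightarrow> m \<noteq> i \<Longrightarrow> m \<noteq> j \<Longrightarrow> \<alpha>\<^sub>1 m = \<alpha>\<^sub>2 m"
    and le: "\<alpha>\<^sub>1 j \<le> \<alpha>\<^sub>2 j" "\<alpha>\<^sub>1 i + \<alpha>\<^sub>1 j \<le> \<alpha>\<^sub>2 i + \<alpha>\<^sub>2 j" "\<beta> j \<le> \<beta> i"
  shows "gamma_conv_le n \<alpha>\<^sub>1 \<beta> \<alpha>\<^sub>2 \<beta>"
proof -
  \<comment> \<open>The whole deficit of the pair total is placed at i; afterwards the totals agree
    and only a transfer to j remains.\<close>
  define \<alpha> where "\<alpha> = \<alpha>\<^sub>1(i := \<alpha>\<^sub>2 i + \<alpha>\<^sub>2 j - \<alpha>\<^sub>1 j)"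
  have "gamma_conv_le n \<alpha>\<^sub>1 \<beta> \<alpha> \<beta>"
    using le(2) \<beta> by (intro gamma_conv_le_raise_shapes) (auto simp: \<alpha>_def)
  moreover have "gamma_conv_le n \<alpha> \<beta> \<alpha>\<^sub>2 \<beta>"
  proof (rule gamma_conv_leI)
    show "(\<Sum>m<n. \<alpha> m) = (\<Sum>m<n. \<alpha>\<^sub>2 m)"
      by (intro antisym sum_mono_pair[OF ij]) (use ij(3) eq in \<open>auto simp: \<alpha>_def\<close>)
    fix x :: real assume x: "0 < x"
    have "0 \<le> (\<alpha>\<^sub>2 j - \<alpha>\<^sub>1 j) * (exp (- \<beta> j * x) - exp (- \<beta> i * x))"
      using le x by (intro mult_nonneg_nonneg) auto
    then show "(\<Sum>m<n. \<alpha> m * exp (- \<beta> m * x)) \<le> (\<Sum>m<n. \<alpha>\<^sub>2 m * exp (- \<beta> m * x))"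
      by (intro sum_mono_pair[OF ij]) (use ij(3) eq in \<open>auto simp: \<alpha>_def algebra_simps\<close>)
  qed (use \<beta> in auto)
  ultimately show ?thesis by (rule gamma_conv_le_trans)
qed

text \<open>Convexity in product form: since c = a + (b - d), the difference of the two sides is
  (exp(-dx) - exp(-ax)) (1 - exp(-(b - d)x)).\<close>

lemma exp_sum_le_spread:
  fixes a b c d x :: real
  assumes "d \<le> a" "d \<le> b" "a + b = c + d" "0 \<le> x"
  shows "exp (- a * x) + exp (- b * x) \<le> exp (- c * x) + exp (- d * x)"
proof -
  have "exp (- c * x) = exp (- a * x) * exp (- (b - d) * x)"
  proof -
    have c: "c = a + (b - d)" using assms(3) by simp
    have "- c * x = - a * x + - (b - d) * x" unfolding c by (simp add: algebra_simps)
    then show ?thesis by (simp only: exp_add)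
  qed
  moreover have "exp (- b * x) = exp (- d * x) * exp (- (b - d) * x)"
    by (simp add: exp_add[symmetric] algebra_simps)
  moreover have "0 \<le> (exp (- d * x) - exp (- a * x)) * (1 - exp (- (b - d) * x))"
  proof (rule mult_nonneg_nonneg)
    show "0 \<le> exp (- d * x) - exp (- a * x)" using assms by (simp add: mult_right_mono)
    have "0 \<le> (b - d) * x" using assms by simp
    then show "0 \<le> 1 - exp (- (b - d) * x)" by (simp only: mult_minus_left) simp
  qed
  ultimately show ?thesis by (simp add: algebra_simps)
qed

text \<open>The common shape \<open>\<alpha> i\<close> of the two coordinates is handled by
  convexity. The excess \<open>\<alpha> j - \<alpha> i\<close> sits at j, where the rate
  drops.\<close>

lemma gamma_conv_le_spread_rates:
  assumes ij: "i < n" "j < n" "i \<noteq> j"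
    and \<beta>: "\<And>m. m < n \<Longrightarrow> 0 < \<beta>\<^sub>1 m" "\<And>m. m < n \<Longrightarrow> 0 < \<beta>\<^sub>2 m"
    and eq: "\<And>m. m < n \<Longrightarrow> m \<noteq> i \<Longrightarrow> m \<noteq> j \<Longrightarrow> \<beta>\<^sub>1 m = \<beta>\<^sub>2 m"
    and \<alpha>: "0 \<le> \<alpha> i" "\<alpha> i \<le> \<alpha> j"
    and le: "\<beta>\<^sub>2 j \<le> \<beta>\<^sub>1 i" "\<beta>\<^sub>2 j \<le> \<beta>\<^sub>1 j" "\<beta>\<^sub>1 i + \<beta>\<^sub>1 j = \<beta>\<^sub>2 i + \<beta>\<^sub>2 j"
  shows "gamma_conv_le n \<alpha> \<beta>\<^sub>1 \<alpha> \<beta>\<^sub>2"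
proof (rule gamma_conv_leI)
  fix x :: real assume x: "0 < x"
  have "0 \<le> \<alpha> i * (exp (- \<beta>\<^sub>2 i * x) + exp (- \<beta>\<^sub>2 j * x) - (exp (- \<beta>\<^sub>1 i * x) + exp (- \<beta>\<^sub>1 j * x)))"
    using exp_sum_le_spread[OF le, of x] x \<alpha> by (intro mult_nonneg_nonneg) auto
  moreover have "0 \<le> (\<alpha> j - \<alpha> i) * (exp (- \<beta>\<^sub>2 j * x) - exp (- \<beta>\<^sub>1 j * x))"
    using le x \<alpha> by (intro mult_nonneg_nonneg) auto
  ultimately show "(\<Sum>m<n. \<alpha> m * exp (- \<beta>\<^sub>1 m * x)) \<le> (\<Sum>m<n. \<alpha> m * exp (- \<beta>\<^sub>2 m * x))"
    by (intro sum_mono_pair[OF ij]) (use eq in \<open>auto simp: algebra_simps\<close>)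
qed (use \<beta> in auto)

text \<open>If j already has the smaller rate, the two rates keep their order along the whole
  segment and the larger weight stays at j. In the other case the two rates are exchanged
  first.\<close>

lemma gamma_st_le_spread_log_rates:
  assumes ij: "i < n" "j < n" "i \<noteq> j"
    and \<alpha>: "\<And>m. m < n \<Longrightarrow> 0 \<le> \<alpha> m" "\<alpha> i \<le> \<alpha> j"
    and eq: "\<And>m. m < n \<Longrightarrow> m \<noteq> i \<Longrightarrow> m \<noteq> j \<Longrightarrow> b m = c m"
    and le: "c j \<le> b i" "c j \<le> b j" "b i + b j = c i + c j"
  shows "gamma_st_le n \<alpha> (\<lambda>i. exp (b i)) \<alpha> (\<lambda>i. exp (c i))"
proof -
  have ordered: "gamma_st_le n \<alpha> (\<lambda>i. exp (b i)) \<alpha> (\<lambda>i. exp (c i))"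
    if le: "c j \<le> b j" "b j \<le> b i" "b i + b j = c i + c j"
      and eq: "\<And>m. m < n \<Longrightarrow> m \<noteq> i \<Longrightarrow> m \<noteq> j \<Longrightarrow> b m = c m" for b
    unfolding gamma_st_le_def
  proof (rule laplace_st_le_log_segment)
    fix \<tau> x :: real assume \<tau>: "0 \<le> \<tau>" "\<tau> \<le> 1" and x: "0 \<le> x"
    let ?e = "\<lambda>m. exp (- exp ((1 - \<tau>) * b m + \<tau> * c m) * x)"
    \<comment> \<open>The endpoint is ordered too: the fixed sum gives c i \<ge> b i \<ge> b j \<ge>
      c j.\<close>
    have "(1 - \<tau>) * b j + \<tau> * c j \<le> (1 - \<tau>) * b i + \<tau> * c i"
      using \<tau> le by (intro add_mono mult_left_mono) auto
    then have "?e i \<le> ?e j" using x by (simp add: mult_right_mono)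
    then have "\<alpha> i * ?e i \<le> \<alpha> j * ?e j" using \<alpha>(2) \<alpha>(1)[OF ij(1)] by (intro mult_mono) auto
    then have "(c i - b i) * (\<alpha> i * ?e i) \<le> (c i - b i) * (\<alpha> j * ?e j)"
      using le by (intro mult_left_mono) auto
    moreover have "c j - b j = - (c i - b i)" using le by simp
    ultimately have "(c i - b i) * (\<alpha> i * ?e i) + (c j - b j) * (\<alpha> j * ?e j) \<le> 0"
      by (simp only: mult_minus_left)
    then have "\<alpha> i * (c i - b i) * ?e i + \<alpha> j * (c j - b j) * ?e j \<le> 0"
      by (simp only: mult_ac)
    then have "(\<Sum>m<n. \<alpha> m * (c m - b m) * ?e m) \<le> (\<Sum>m<n. 0)"
      using eq by (intro sum_mono_pair[OF ij]) auto
    then show "(\<Sum>m<n. \<alpha> m * (c m - b m) * ?e m) \<le> 0" by simp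
  qed (use \<alpha> in auto)
  show ?thesis
  proof (cases "b j \<le> b i")
    case True
    show ?thesis by (rule ordered[OF le(2) True le(3) eq])
  next
    case False
    \<comment> \<open>The exchange preserves the sum of the two rates and gives the smaller one to
      the larger shape, so it is a spread of rates and falls under the convolution order.\<close>
    define b' where "b' = b(i := b j, j := b i)"
    have "gamma_conv_le n \<alpha> (\<lambda>i. exp (b i)) \<alpha> (\<lambda>i. exp (b' i))"
      using False ij \<alpha> by (intro gamma_conv_le_spread_rates[OF ij]) (auto simp: b'_def)
    then have "gamma_st_le n \<alpha> (\<lambda>i. exp (b i)) \<alpha> (\<lambda>i. exp (b' i))"
      using \<alpha> by (intro gamma_conv_imp_st_le) auto
    moreover have "gamma_st_le n \<alpha> (\<lambda>i. exp (b' i)) \<alpha> (\<lambda>i. exp (c i))"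
      using False ij eq le by (intro ordered) (auto simp: b'_def)
    ultimately show ?thesis by (rule gamma_st_le_trans)
  qed
qed

section \<open>Chains of pairs of vectors\<close>

lemma gamma_exponent_cong:
  assumes "\<And>i. i < n \<Longrightarrow> \<alpha>\<^sub>1 i = \<alpha>\<^sub>2 i" "\<And>i. i < n \<Longrightarrow> \<beta>\<^sub>1 i = \<beta>\<^sub>2 i"
  shows "gamma_exponent n \<alpha>\<^sub>1 \<beta>\<^sub>1 = gamma_exponent n \<alpha>\<^sub>2 \<beta>\<^sub>2"
  using assms by (auto simp: gamma_exponent_def fun_eq_iff)

text \<open>A common permutation only reorders the summands of the exponent. The functions f and g
  let this serve truncated shapes and rates given by their logarithms.\<close>

lemma arr_eqD:
  assumes "arr_eq (x\<^sub>1, y\<^sub>1) (x\<^sub>2, y\<^sub>2)" "length x\<^sub>2 = n"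
  shows "length x\<^sub>1 = n" "length y\<^sub>1 = n" "length y\<^sub>2 = n" "mset x\<^sub>1 = mset x\<^sub>2" "mset y\<^sub>1 = mset y\<^sub>2"
    "gamma_exponent n (\<lambda>i. f (x\<^sub>1 ! i)) (\<lambda>i. g (y\<^sub>1 ! i)) = gamma_exponent n (\<lambda>i. f (x\<^sub>2 ! i))
        (\<lambda>i. g (y\<^sub>2 ! i))"
proof -
  have y\<^sub>2: "length y\<^sub>2 = n" and "\<exists>\<pi>. \<pi> permutes {..<n} \<and> x\<^sub>1 = permute_list \<pi> x\<^sub>2 \<and> y\<^sub>1
      = permute_list \<pi> y\<^sub>2"
    using assms(1) unfolding arr_eq_def prod.case assms(2) by blast+
  then obtain \<pi> where \<pi>: "\<pi> permutes {..<n}" and x\<^sub>1: "x\<^sub>1 = permute_list \<pi> x\<^sub>2" and y\<^sub>1: "y\<^sub>1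
      = permute_list \<pi> y\<^sub>2"
    by blast
  show "length x\<^sub>1 = n" "length y\<^sub>1 = n" "length y\<^sub>2 = n" unfolding x\<^sub>1 y\<^sub>1 using assms(2) y\<^sub>2
      by simp_all
  show "mset x\<^sub>1 = mset x\<^sub>2" unfolding x\<^sub>1 by (rule mset_permute_list) (use \<pi> assms(2) in simp)
  show "mset y\<^sub>1 = mset y\<^sub>2" unfolding y\<^sub>1 by (rule mset_permute_list) (use \<pi> y\<^sub>2 in simp)
  have nth: "x\<^sub>1 ! i = x\<^sub>2 ! \<pi> i" "y\<^sub>1 ! i = y\<^sub>2 ! \<pi> i" if "i < n" for i
    unfolding x\<^sub>1 y\<^sub>1 using that \<pi> assms(2) y\<^sub>2 by (simp_all add: permute_list_nth)
  have "(\<Sum>i<n. f (x\<^sub>1 ! i) * ln (g (y\<^sub>1 ! i) / (g (y\<^sub>1 ! i) + s))) = (\<Sum>i<n. f (x\<^sub>2 ! i) * ln (g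
      (y\<^sub>2 ! i) / (g (y\<^sub>2 ! i) + s)))" for s
    unfolding sum.permute[OF \<pi>, of "\<lambda>i. f (x\<^sub>2 ! i) * ln (g (y\<^sub>2 ! i) / (g (y\<^sub>2 ! i) + s))"]
    by (rule sum.cong) (simp_all add: nth)
  then show "gamma_exponent n (\<lambda>i. f (x\<^sub>1 ! i)) (\<lambda>i. g (y\<^sub>1 ! i)) = gamma_exponent n (\<lambda>i. f
      (x\<^sub>2 ! i)) (\<lambda>i. g (y\<^sub>2 ! i))"
    by (simp add: gamma_exponent_def fun_eq_iff)
qed

lemma major_pairD:
  assumes "major [a, b] [c, d]"
  shows "max a b \<le> max c d" "a + b = c + d"
proof -
  have "weak_sub_major [a, b] [c, d]" using assms by (simp add: major_def)
  then have "\<forall>k\<in>{1..length [a, b]}. sum_list (take k (rev (sort [a, b]))) \<le> sum_list (take k (rev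
      (sort [c, d])))"
    unfolding weak_sub_major_def decreasing_vec_def by (rule conjunct2)
  then have "sum_list (take 1 (rev (sort [a, b]))) \<le> sum_list (take 1 (rev (sort [c, d])))"
    by (rule bspec) simp
  then show "max a b \<le> max c d" by (cases "a \<le> b"; cases "c \<le> d") simp_all
  have "sum_list [a, b] = sum_list [c, d]" using assms unfolding major_def by (rule conjunct2)
  then show "a + b = c + d" by simp
qed

lemma oppositely_ordered_cases:
  fixes a b c d :: real
  assumes "(d - c) * (b - a) \<le> 0"
  obtains "a \<le> b" "d \<le> c" | "b \<le> a" "c \<le> d"
  using assms by (cases "a \<le> b"; cases "c \<le> d") (auto simp: mult_le_0_iff)

text \<open>Truncation at 0 is convex, and a convex function has the larger sum over the majorizing
  pair.\<close>

lemma max_0_sum_le: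
  fixes a b c d :: real
  assumes "max a b \<le> max c d" "a + b = c + d"
  shows "max 0 a + max 0 b \<le> max 0 c + max 0 d"
  using assms by (auto simp: max_def split: if_splits)

text \<open>Opposite ordering puts the larger final shape at the smaller rate, and the bound on the
  maxima says that the shape grows there.\<close>

lemma gamma_conv_le_major_shapes:
  fixes x\<^sub>1 x\<^sub>2 \<beta> :: "nat \<Rightarrow> real"
  assumes ij: "i < n" "j < n" "i \<noteq> j" and \<beta>: "\<And>m. m < n \<Longrightarrow> 0 < \<beta> m"
    and opp: "(\<beta> j - \<beta> i) * (x\<^sub>2 j - x\<^sub>2 i) \<le> 0"
    and maj: "max (x\<^sub>1 i) (x\<^sub>1 j) \<le> max (x\<^sub>2 i) (x\<^sub>2 j)" "x\<^sub>1 i + x\<^sub>1 j = x\<^sub>2 i + x\<^sub>2 j"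
    and eq: "\<And>m. m < n \<Longrightarrow> m \<noteq> i \<Longrightarrow> m \<noteq> j \<Longrightarrow> x\<^sub>1 m = x\<^sub>2 m"
  shows "gamma_conv_le n (\<lambda>m. max 0 (x\<^sub>1 m)) \<beta> (\<lambda>m. max 0 (x\<^sub>2 m)) \<beta>"
proof -
  have eq': "max 0 (x\<^sub>1 m) = max 0 (x\<^sub>2 m)" if "m < n" "m \<noteq> i" "m \<noteq> j" for m
    using eq[OF that] by simp
  have sum: "max 0 (x\<^sub>1 i) + max 0 (x\<^sub>1 j) \<le> max 0 (x\<^sub>2 i) + max 0 (x\<^sub>2 j)"
    "max 0 (x\<^sub>1 j) + max 0 (x\<^sub>1 i) \<le> max 0 (x\<^sub>2 j) + max 0 (x\<^sub>2 i)"
    using max_0_sum_le[OF maj] by simp_all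
  from opp show ?thesis
  proof (cases rule: oppositely_ordered_cases)
    case 1
    then show ?thesis using maj(1)
      by (intro gamma_conv_le_spread_shapes[of i n j, OF ij \<beta> eq' _ sum(1)]) auto
  next
    case 2
    then show ?thesis using maj(1)
      by (intro gamma_conv_le_spread_shapes[of j n i, OF ij(2,1) ij(3)[symmetric] \<beta> eq' _ sum(2)]) auto
  qed
qed

text \<open>The intermediate shapes of a chain may be negative, and then lowering a rate need not increase the
  sum. Replacing every shape \<open>x\<close> by \<open>max 0 x\<close> turns the chain into one with nonnegative shapes.\<close>

lemma gamma_conv_le_rc_step:
  assumes "rc_step n p q" "\<forall>i<n. 0 < snd q ! i"
  shows "(\<forall>i<n. 0 < snd p ! i) \<and>
    gamma_conv_le n (\<lambda>i. max 0 (fst p ! i)) ((!) (snd p)) (\<lambda>i. max 0 (fst q ! i)) ((!) (snd q))"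
  using assms(1)
proof cases
  case (spread_fst x\<^sub>1 x\<^sub>2 y i j)
  note maj = major_pairD[OF spread_fst(9)]
  have y: "\<And>m. m < n \<Longrightarrow> 0 < y ! m" using assms(2) spread_fst(2) by simp
  have "gamma_conv_le n (\<lambda>i. max 0 (x\<^sub>1 ! i)) ((!) y) (\<lambda>i. max 0 (x\<^sub>2 ! i)) ((!) y)"
    using spread_fst(6,7,10) by (intro gamma_conv_le_major_shapes[OF _ _ _ y spread_fst(8) maj]) auto
  then show ?thesis unfolding spread_fst(1,2) using y by simp
next
  case (spread_snd x y\<^sub>1 y\<^sub>2 i j)
  note maj = major_pairD[OF spread_snd(9)]
  have y2: "\<And>m. m < n \<Longrightarrow> 0 < y\<^sub>2 ! m" using assms(2) spread_snd(2) by simp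
  have ij: "i < n" "j < n" "i \<noteq> j" "j \<noteq> i" using spread_snd(6,7) by auto
  have eq: "y\<^sub>1 ! m = y\<^sub>2 ! m" if "m < n" "m \<noteq> i" "m \<noteq> j" for m
    using spread_snd(10) that by simp
  \<comment> \<open>With equal sums, a bound on the maximum is a bound on the minimum: neither entry
    is below the smaller entry of the final pair.\<close>
  have "0 < y\<^sub>1 ! i" "0 < y\<^sub>1 ! j"
    using maj y2[OF ij(1)] y2[OF ij(2)] by linarith+
  then have y1: "0 < y\<^sub>1 ! m" if "m < n" for m
    using eq[OF that] y2[OF that] by (cases "m = i \<or> m = j") auto
  have "gamma_conv_le n (\<lambda>i. max 0 (x ! i)) ((!) y\<^sub>1) (\<lambda>i. max 0 (x ! i)) ((!) y\<^sub>2)"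
    using spread_snd(8)
  proof (cases rule: oppositely_ordered_cases)
    case 1
    then show ?thesis using maj
      by (intro gamma_conv_le_spread_rates[of i n j, OF ij(1-3) y1 y2 eq]) auto
  next
    case 2
    then show ?thesis using maj
      by (intro gamma_conv_le_spread_rates[of j n i, OF ij(2,1,4) y1 y2 eq]) auto
  qed
  then show ?thesis unfolding spread_snd(1,2) using y1 by simp
next
  case (raise_fst x\<^sub>1 x\<^sub>2 y)
  have "max 0 (x\<^sub>1 ! i) \<le> max 0 (x\<^sub>2 ! i)" if "i < n" for i
    using raise_fst(6) that by (intro max.mono) auto
  then show ?thesis
    using assms(2) raise_fst(1,2) by (auto intro: gamma_conv_le_raise_shapes)
next
  case (lower_snd x y\<^sub>1 y\<^sub>2)
  have "\<forall>i<n. 0 < y\<^sub>1 ! i" using assms(2) lower_snd(2,6) by (metis order.strict_trans2 snd_conv)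
  then show ?thesis
    using assms(2) lower_snd(1,2,6) by (auto intro!: gamma_conv_le_lower_rates)
next
  case (perm x\<^sub>2 y\<^sub>2 x\<^sub>1 y\<^sub>1)
  note D = arr_eqD[OF perm(5,3)]
  have "set y\<^sub>1 = set y\<^sub>2" using D(5) by (rule mset_eq_setD)
  moreover have "\<forall>z\<in>set y\<^sub>2. 0 < z" using assms(2) perm(2,4) by (auto simp: in_set_conv_nth)
  ultimately have "\<forall>i<n. 0 < y\<^sub>1 ! i" using D(2) by auto
  moreover have "gamma_conv_le n (\<lambda>i. max 0 (x\<^sub>1 ! i)) ((!) y\<^sub>1) (\<lambda>i. max 0 (x\<^sub>2 ! i)) ((!) y\<^sub>2)"
    using D(6)[of "max 0" id] by (intro gamma_conv_le_same) simp
  ultimately show ?thesis unfolding perm(1,2) by simp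
qed

text \<open>Positive rates are known at the upper end only. No step lowers the least rate when
  followed backwards, so the induction starts at the upper end and carries positivity along.\<close>

lemma gamma_conv_le_rc_le:
  assumes "rc_le n p q" "\<forall>i<n. 0 < snd q ! i"
  shows "(\<forall>i<n. 0 < snd p ! i) \<and>
    gamma_conv_le n (\<lambda>i. max 0 (fst p ! i)) ((!) (snd p)) (\<lambda>i. max 0 (fst q ! i)) ((!) (snd q))"
  using assms(1) unfolding rc_le_def
proof (induction rule: converse_rtranclp_induct)
  case base
  then show ?case using assms(2) by (simp add: gamma_conv_le_same)
next
  case (step p p')
  note le = gamma_conv_le_rc_step[OF step(1) conjunct1[OF step.IH]]
  show ?case using conjunct1[OF le] gamma_conv_le_trans[OF conjunct2[OF le] conjunct2[OF step.IH]]
      by (rule conjI)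
qed

text \<open>The second components are now log-rates. Since exp is increasing, all steps except the
  spread of log-rates reduce to the convolution order.\<close>

lemma gamma_st_le_rc_step:
  assumes "rc_step n p q"
  shows "gamma_st_le n (\<lambda>i. max 0 (fst p ! i)) (\<lambda>i. exp (snd p ! i)) (\<lambda>i. max 0 (fst q ! i))
      (\<lambda>i. exp (snd q ! i))"
  using assms
proof cases
  case (spread_snd x y\<^sub>1 y\<^sub>2 i j)
  note maj = major_pairD[OF spread_snd(9)]
  have ij: "i < n" "j < n" "i \<noteq> j" "j \<noteq> i" using spread_snd(6,7) by auto
  have eq: "y\<^sub>1 ! m = y\<^sub>2 ! m" if "m < n" "m \<noteq> i" "m \<noteq> j" for m
    using spread_snd(10) that by simp
  have "gamma_st_le n (\<lambda>i. max 0 (x ! i)) (\<lambda>i. exp (y\<^sub>1 ! i)) (\<lambda>i. max 0 (x ! i)) (\<lambda>i. exp (y\<^sub>2 ! i))"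
    using spread_snd(8)
  proof (cases rule: oppositely_ordered_cases)
    case 1
    then show ?thesis using maj
      by (intro gamma_st_le_spread_log_rates[of i n j, OF ij(1-3) _ _ eq]) auto
  next
    case 2
    then show ?thesis using maj
      by (intro gamma_st_le_spread_log_rates[of j n i, OF ij(2,1,4) _ _ eq]) auto
  qed
  then show ?thesis unfolding spread_snd(1,2) by simp
next
  case (lower_snd x y\<^sub>1 y\<^sub>2)
  have "gamma_conv_le n (\<lambda>i. max 0 (x ! i)) (\<lambda>i. exp (y\<^sub>1 ! i)) (\<lambda>i. max 0 (x ! i)) (\<lambda>i. exp (y\<^sub>2 ! i))"
    using lower_snd(6) by (intro gamma_conv_le_lower_rates) auto
  then show ?thesis
    unfolding lower_snd(1,2) by (intro gamma_conv_imp_st_le) auto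
next
  case (perm x\<^sub>2 y\<^sub>2 x\<^sub>1 y\<^sub>1)
  show ?thesis
    unfolding perm(1,2) using arr_eqD(6)[OF perm(5,3), of "max 0" exp]
    by (intro gamma_conv_imp_st_le gamma_conv_le_same) auto
next
  case (raise_fst x\<^sub>1 x\<^sub>2 y)
  have "max 0 (x\<^sub>1 ! i) \<le> max 0 (x\<^sub>2 ! i)" if "i < n" for i
    using raise_fst(6) that by (intro max.mono) auto
  then have "gamma_conv_le n (\<lambda>i. max 0 (x\<^sub>1 ! i)) (\<lambda>i. exp (y ! i)) (\<lambda>i. max 0 (x\<^sub>2 ! i)) (\<lambda>i. exp
      (y ! i))"
    by (intro gamma_conv_le_raise_shapes) auto
  then show ?thesis
    unfolding raise_fst(1,2) by (intro gamma_conv_imp_st_le) auto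
next
  case (spread_fst x\<^sub>1 x\<^sub>2 y i j)
  have opp: "(exp (y ! j) - exp (y ! i)) * (x\<^sub>2 ! j - x\<^sub>2 ! i) \<le> 0"
    using spread_fst(8) by (auto simp: mult_le_0_iff)
  have "gamma_conv_le n (\<lambda>i. max 0 (x\<^sub>1 ! i)) (\<lambda>i. exp (y ! i)) (\<lambda>i. max 0 (x\<^sub>2 ! i)) (\<lambda>i. exp (y ! i))"
    using spread_fst(6,7,10)
    by (intro gamma_conv_le_major_shapes[OF _ _ _ _ opp major_pairD[OF spread_fst(9)]]) auto
  then show ?thesis
    unfolding spread_fst(1,2) by (intro gamma_conv_imp_st_le) auto
qed

lemma gamma_st_le_rc_le:
  assumes "rc_le n p q"
  shows "gamma_st_le n (\<lambda>i. max 0 (fst p ! i)) (\<lambda>i. exp (snd p ! i)) (\<lambda>i. max 0 (fst q ! i))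
      (\<lambda>i. exp (snd q ! i))"
  using assms unfolding rc_le_def
proof (induction rule: converse_rtranclp_induct)
  case base
  then show ?case by (simp add: gamma_st_le_def laplace_st_le_def)
next
  case (step p p')
  show ?case by (rule gamma_st_le_trans[OF gamma_st_le_rc_step[OF step(1)] step.IH])
qed

text \<open>Each swap gives the larger rate to the later, hence larger, shape. Undoing it is a
  spread of rates with an unchanged pair of values, so the sums decrease along the list.\<close>

lemma gamma_conv_le_sorting_swaps:
  assumes "successively sorting_swap \<phi>" "\<phi> \<noteq> []"
    and "length (hd \<phi>) = n" "\<forall>i<n. 0 < hd \<phi> ! i"
    and x: "sorted x" "length x = n" "\<forall>i<n. 0 \<le> x ! i"
  shows "gamma_conv_le n ((!) x) ((!) (last \<phi>)) ((!) x) ((!) (hd \<phi>))"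
  using assms(1-4)
proof (induction \<phi> rule: induct_list012)
  case (2 y)
  then show ?case by (simp add: gamma_conv_le_same)
next
  case (3 y z \<phi>)
  from 3(3) obtain i j where ij: "i < j" "j < length y" "y ! j < y ! i" "z = y[i := y ! j, j := y ! i]"
    by (auto simp: sorting_swap_def)
  have y: "length y = n" "\<And>m. m < n \<Longrightarrow> 0 < y ! m" using 3 by auto
  have z: "length z = n" "\<And>m. m < n \<Longrightarrow> 0 < z ! m" using ij y by (auto simp: nth_list_update)
  have zy: "gamma_conv_le n ((!) x) ((!) z) ((!) x) ((!) y)"
    by (rule gamma_conv_le_spread_rates[of i n j])
      (use ij y z x in \<open>auto simp: nth_list_update sorted_iff_nth_mono\<close>)
  have "gamma_conv_le n ((!) x) ((!) (last (z # \<phi>))) ((!) x) ((!) (hd (z # \<phi>)))"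
    using 3 z by (intro 3(2)) auto
  then have "gamma_conv_le n ((!) x) ((!) (last (z # \<phi>))) ((!) x) ((!) z)" by simp
  from gamma_conv_le_trans[OF this zy] show ?case by simp
qed auto

section \<open>Oppositely ordered vectors\<close>

text \<open>With tail sums D_k of d, the sum equals w_0 D_0 plus the terms (w_k - w_(k-1)) D_k, all
  of them nonnegative. The induction removes the weights from the top index downwards.\<close>

lemma sum_mult_nonneg_Abel:
  fixes w d :: "nat \<Rightarrow> real"
  assumes w: "\<And>i j. i \<le> j \<Longrightarrow> j < n \<Longrightarrow> w i \<le> w j" "\<And>i. i < n \<Longrightarrow> 0 \<le> w i"
    and d: "\<And>k. k < n \<Longrightarrow> 0 \<le> (\<Sum>i=k..<n. d i)"
  shows "0 \<le> (\<Sum>i<n. w i * d i)"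
proof (cases "n = 0")
  case False
  have "w k * (\<Sum>i=k..<n. d i) \<le> (\<Sum>i=k..<n. w i * d i)" if "k \<le> n - 1" for k
    using that
  proof (induction rule: inc_induct)
    case base
    have "{n - 1..<n} = {n - 1}" using False by auto
    then show ?case by simp
  next
    case (step k)
    then have k: "Suc k < n" by simp
    have split: "sum f {k..<n} = f k + sum f {Suc k..<n}" for f :: "nat \<Rightarrow> real"
      using k by (intro sum.atLeast_Suc_lessThan) simp
    have "w k * (\<Sum>i=Suc k..<n. d i) \<le> w (Suc k) * (\<Sum>i=Suc k..<n. d i)"
      using w(1)[of k "Suc k"] d[OF k] k by (intro mult_right_mono) auto
    then show ?case using step.IH by (simp add: split distrib_left)
  qed
  from this[of 0] have "w 0 * (\<Sum>i=0..<n. d i) \<le> (\<Sum>i<n. w i * d i)" by (simp add: atLeast0LessThan)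
  moreover have "0 \<le> w 0 * (\<Sum>i=0..<n. d i)" using w(2)[of 0] d[of 0] False by
      (intro mult_nonneg_nonneg) auto
  ultimately show ?thesis by simp
qed simp

section \<open>Sorting and tail sums\<close>

lemma nth_sort_all:
  assumes "\<forall>i<n. P (xs ! i)" "length xs = n" "i < n"
  shows "P (sort xs ! i)" "P (rev (sort xs) ! i)"
proof -
  have "\<forall>x\<in>set xs. P x" using assms by (auto simp: in_set_conv_nth)
  moreover have "sort xs ! i \<in> set xs" "rev (sort xs) ! i \<in> set xs"
    using nth_mem[of i "sort xs"] nth_mem[of i "rev (sort xs)"] assms by simp_all
  ultimately show "P (sort xs ! i)" "P (rev (sort xs) ! i)" by auto
qed

text \<open>For a threshold v the total of max(0, x - v) over all entries is invariant under
  permutation. It bounds the sum of x - v over any m entries and, for v the m-th largest entry, is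
  attained by the m largest.\<close>

lemma sum_list_take_le_sorted:
  fixes xs :: "real list"
  assumes "m \<le> length xs"
  shows "sum_list (take m xs) \<le> sum_list (take m (rev (sort xs)))"
proof (cases "m = 0")
  case False
  define ys where "ys = rev (sort xs)"
  \<comment> \<open>Entries at indices below m are at least v, those from m on at most v.\<close>
  define v where "v = ys ! (m - 1)"
  have len: "length ys = length xs" by (simp add: ys_def)
  have dec: "ys ! j \<le> ys ! i" if "i \<le> j" "j < length ys" for i j
  proof -
    have "sorted (rev ys)" by (simp add: ys_def)
    then show ?thesis using that by (simp add: sorted_rev_iff_nth_mono)
  qed
  have shift: "sum_list (map (\<lambda>x. x - v) zs) = sum_list zs - real (length zs) * v" for zs
    by (induction zs) (auto simp: algebra_simps)
  have "sum_list (map (\<lambda>x. x - v) (take m xs)) \<le> sum_list (map (\<lambda>x. max 0 (x - v)) (take m xs))"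
    by (intro sum_list_mono) auto
  also have "\<dots> \<le> sum_list (map (\<lambda>x. max 0 (x - v)) (take m xs)) + sum_list (map (\<lambda>x. max 0 (x - v))
      (drop m xs))"
    by (auto intro!: sum_list_nonneg)
  also have "\<dots> = sum_list (map (\<lambda>x. max 0 (x - v)) xs)"
    by (simp only: sum_list_append[symmetric] map_append[symmetric] append_take_drop_id)
  also have "\<dots> = sum_list (map (\<lambda>x. max 0 (x - v)) ys)"
  proof -
    have "mset (map (\<lambda>x. max 0 (x - v)) xs) = mset (map (\<lambda>x. max 0 (x - v)) ys)" by (simp add: ys_def)
    then show ?thesis by (metis sum_mset_sum_list)
  qed
  also have "\<dots> = sum_list (map (\<lambda>x. max 0 (x - v)) (take m ys)) + sum_list (map (\<lambda>x. max 0 (x - v))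
      (drop m ys))"
    by (simp only: sum_list_append[symmetric] map_append[symmetric] append_take_drop_id)
  also have "map (\<lambda>x. max 0 (x - v)) (take m ys) = map (\<lambda>x. x - v) (take m ys)"
  proof (rule map_cong[OF refl])
    fix x assume "x \<in> set (take m ys)"
    then obtain i where "i < m" "x = ys ! i" using assms len by (auto simp: in_set_conv_nth)
    then show "max 0 (x - v) = x - v" using dec[of i "m - 1"] assms len False by (simp add: v_def)
  qed
  also have "map (\<lambda>x. max 0 (x - v)) (drop m ys) = map (\<lambda>x. 0) (drop m ys)"
  proof (rule map_cong[OF refl])
    fix x assume "x \<in> set (drop m ys)"
    then obtain i where "i < length ys - m" "x = ys ! (m + i)" using assms len by
        (auto simp: in_set_conv_nth)
    then show "max 0 (x - v) = 0" using dec[of "m - 1" "m + i"] assms len False by (simp add: v_def)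
  qed
  also have "sum_list (map (\<lambda>x. 0) (drop m ys)) = (0::real)" by
      (simp add: map_replicate_const sum_list_replicate)
  finally show ?thesis using assms by (simp add: shift len ys_def)
qed simp

lemma sum_nth_tail:
  fixes xs :: "real list"
  assumes "length xs = n" "k \<le> n"
  shows "(\<Sum>i=k..<n. xs ! i) = sum_list (take (n - k) (rev xs))"
proof -
  have "(\<Sum>i=k..<n. xs ! i) = sum_list (drop k xs)"
    using assms sum.shift_bounds_nat_ivl[of "(!) xs" 0 k "n - k"]
    by (simp add: sum_list_sum_nth add.commute)
  also have "\<dots> = sum_list (take (n - k) (rev xs))"
    using assms by (simp add: take_rev sum_list_rev)
  finally show ?thesis .
qed

lemma gamma_exponent_zip:
  assumes "length x = n" "length y = n"
  shows "gamma_exponent n ((!) x) ((!) y) s = sum_list (map (\<lambda>(a, b). a * ln (b / (b + s))) (zip x y))"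
  unfolding gamma_exponent_def sum_list_sum_nth atLeast0LessThan using assms by (intro sum.cong) auto

text \<open>The pairs are sorted by rate, each shape travelling with its rate. The transform is
  unchanged, and the shapes end up in some order \<open>a\<close> of no particular form.\<close>

lemma sort_rates:
  fixes x y :: "real list"
  assumes len: "length x = n" "length y = n"
  obtains a where "length a = n" "mset a = mset x"
    "gamma_exponent n ((!) x) ((!) y) = gamma_exponent n ((!) a) ((!) (rev (sort y)))"
proof
  define ps where "ps = rev (sort_key snd (zip x y))"
  have ms: "mset ps = mset (zip x y)" by (simp add: ps_def)
  have lps: "length ps = n" using len by (simp add: ps_def)
  show "length (map fst ps) = n" using lps by simp
  show "mset (map fst ps) = mset x"
  proof -
    have "image_mset fst (mset (zip x y)) = mset x"
      unfolding mset_map[symmetric] using len by simp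
    then show ?thesis by (simp add: ms)
  qed
  have "image_mset snd (mset (zip x y)) = mset y"
    unfolding mset_map[symmetric] using len by simp
  then have "sort y = map snd (sort_key snd (zip x y))"
    by (intro properties_for_sort) auto
  then have snd: "rev (sort y) = map snd ps" by (simp add: ps_def rev_map)
  show "gamma_exponent n ((!) x) ((!) y) = gamma_exponent n ((!) (map fst ps)) ((!) (rev (sort y)))"
  proof
    fix s
    have "gamma_exponent n ((!) x) ((!) y) s = sum_mset (mset (map (\<lambda>(a, b). a * ln (b / (b + s)))
        (zip x y)))"
      unfolding sum_mset_sum_list by (rule gamma_exponent_zip[OF len])
    also have "\<dots> = sum_mset (mset (map (\<lambda>(a, b). a * ln (b / (b + s))) ps))"
      by (simp only: mset_map ms)
    also have "\<dots> = gamma_exponent n ((!) (map fst ps)) ((!) (map snd ps)) s"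
      unfolding sum_mset_sum_list using gamma_exponent_zip[of "map fst ps" n "map snd ps"] lps
      by (simp only: length_map zip_map_fst_snd)
    finally show "gamma_exponent n ((!) x) ((!) y) s = gamma_exponent n ((!) (map fst ps)) ((!) (rev
        (sort y))) s"
      unfolding snd .
  qed
qed

text \<open>A tail of \<open>a\<close>, in whatever order, is at most the sum of as many largest
  entries of \<open>x\<close>; majorization compares these with the largest entries of
  \<open>y\<close>, which form the tail of \<open>sort y\<close>.\<close>

lemma weak_sub_major_tails:
  assumes "weak_sub_major x y" "length x = n" "length y = n" "mset a = mset x" "k < n"
  shows "(\<Sum>i=k..<n. a ! i) \<le> (\<Sum>i=k..<n. sort y ! i)"
proof -
  have a: "length a = n" using assms(2,4) by (metis size_mset)
  have "(\<Sum>i=k..<n. a ! i) = sum_list (take (n - k) (rev a))"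
    using a assms(5) by (simp add: sum_nth_tail)
  also have "\<dots> \<le> sum_list (take (n - k) (rev (sort (rev a))))"
    using a by (intro sum_list_take_le_sorted) simp
  also have "sort (rev a) = sort x" using assms(4) by (intro properties_for_sort) auto
  also have "sum_list (take (n - k) (rev (sort x))) \<le> sum_list (take (n - k) (rev (sort y)))"
    using conjunct2[OF assms(1)[unfolded weak_sub_major_def decreasing_vec_def]]
    by (rule bspec) (use assms(2,5) in simp)
  also have "\<dots> = (\<Sum>i=k..<n. sort y ! i)" using assms(3,5) by (simp add: sum_nth_tail)
  finally show ?thesis .
qed

lemma weak_sup_major_tails:
  assumes "weak_sup_major x y" "length x = n" "length y = n" "k < n"
  shows "(\<Sum>i=k..<n. rev (sort y) ! i) \<le> (\<Sum>i=k..<n. rev (sort x) ! i)"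
proof -
  have "sum_list (take (n - k) (sort y)) \<le> sum_list (take (n - k) (sort x))"
    using conjunct2[OF assms(1)[unfolded weak_sup_major_def increasing_vec_def]]
    by (rule bspec) (use assms(2,4) in simp)
  moreover have "(\<Sum>i=k..<n. rev (sort z) ! i) = sum_list (take (n - k) (sort z))" if "length z
      = n" for z :: "real list"
    using sum_nth_tail[of "rev (sort z)" n k] that assms(4) unfolding rev_rev_ident by simp
  ultimately show ?thesis using assms(2,3) by simp
qed

text \<open>The change of shapes at fixed rates. With the rates decreasing, the weights exp(-B x)
  increase, and Abel summation applies to the tail sums of the differences of shapes.\<close>

lemma gamma_conv_le_weak_sub_major:
  assumes maj: "weak_sub_major \<alpha>\<^sub>1 \<alpha>\<^sub>2" and len: "length \<alpha>\<^sub>1 = n" "length \<alpha>\<^sub>2 = n" "length \<beta> = n"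
    and n: "0 < n" and pos: "\<forall>i<n. 0 < \<beta> ! i"
  shows "gamma_conv_le n ((!) \<alpha>\<^sub>1) ((!) \<beta>) ((!) (sort \<alpha>\<^sub>2)) ((!) (rev (sort \<beta>)))"
proof -
  define A where "A = (!) (sort \<alpha>\<^sub>2)"
  define B where "B = (!) (rev (sort \<beta>))"
  obtain a where a: "length a = n" "mset a = mset \<alpha>\<^sub>1"
    "gamma_exponent n ((!) \<alpha>\<^sub>1) ((!) \<beta>) = gamma_exponent n ((!) a) B"
    unfolding B_def using sort_rates[OF len(1,3)] .
  have B: "0 < B i" if "i < n" for i
    unfolding B_def using pos len(3) that by (rule nth_sort_all)
  have tails: "(\<Sum>i=k..<n. a ! i) \<le> (\<Sum>i=k..<n. A i)" if "k < n" for k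
    unfolding A_def using maj len(1,2) a(2) that by (rule weak_sub_major_tails)
  \<comment> \<open>The missing total shape goes to index 0: this affects only the tail sum starting
    at 0, where it produces equality, and leaves all other tail inequalities intact.\<close>
  define d where "d = (\<Sum>i<n. A i) - (\<Sum>i<n. a ! i)"
  define a' where "a' i = a ! i + (if i = 0 then d else 0)" for i
  have d: "0 \<le> d" using tails[OF n] by (simp add: d_def atLeast0LessThan)
  have a'_tails: "(\<Sum>i=k..<n. a' i) = (\<Sum>i=k..<n. a ! i) + (if k = 0 then d else 0)" for k
    using n by (simp add: a'_def sum.distrib)
  have tot: "(\<Sum>i<n. a' i) = (\<Sum>i<n. A i)"
    using a'_tails[of 0] by (simp add: d_def atLeast0LessThan)
  have "gamma_conv_le n ((!) a) B a' B"
    using d B by (intro gamma_conv_le_raise_shapes) (auto simp: a'_def)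
  moreover have "gamma_conv_le n a' B A B"
  proof (rule gamma_conv_leI[OF B B tot])
    fix x :: real assume x: "0 < x"
    have "0 \<le> (\<Sum>i<n. exp (- B i * x) * (A i - a' i))"
    proof (rule sum_mult_nonneg_Abel)
      have "sorted (rev (rev (sort \<beta>)))" by simp
      then have "B j \<le> B i" if "i \<le> j" "j < n" for i j
        using that len unfolding B_def by (simp add: sorted_rev_iff_nth_mono del: rev_rev_ident)
      then show "exp (- B i * x) \<le> exp (- B j * x)" if "i \<le> j" "j < n" for i j
        using that x by simp
      show "0 \<le> (\<Sum>i=k..<n. A i - a' i)" if "k < n" for k
        using tails[OF that] a'_tails[of k] tot by (auto simp: sum_subtractf atLeast0LessThan)
    qed auto
    then show "(\<Sum>i<n. a' i * exp (- B i * x)) \<le> (\<Sum>i<n. A i * exp (- B i * x))"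
      by (simp add: left_diff_distrib sum_subtractf mult.commute)
  qed auto
  ultimately show ?thesis
    unfolding A_def B_def by (rule gamma_conv_le_trans[OF gamma_conv_le_same[OF a(3)[unfolded
        B_def]] gamma_conv_le_trans])
qed

text \<open>The change of rates at fixed shapes. The tangent bound for exp at the first rate makes
  the comparison linear in the rate differences, with weights A exp(-B x), B the first rate vector.
  They increase because A increases and B decreases, so Abel summation applies.\<close>

lemma gamma_conv_le_weak_sup_major:
  assumes maj: "weak_sup_major \<beta>\<^sub>1 \<beta>\<^sub>2" and len: "length \<alpha> = n" "length \<beta>\<^sub>1 = n" "length \<beta>\<^sub>2 = n"
    and pos: "\<forall>i<n. 0 \<le> \<alpha> ! i" "\<forall>i<n. 0 < \<beta>\<^sub>1 ! i" "\<forall>i<n. 0 < \<beta>\<^sub>2 ! i"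
  shows "gamma_conv_le n ((!) (sort \<alpha>)) ((!) (rev (sort \<beta>\<^sub>1))) ((!) (sort \<alpha>)) ((!) (rev (sort \<beta>\<^sub>2)))"
proof -
  define A where "A = (!) (sort \<alpha>)"
  define B\<^sub>1 where "B\<^sub>1 = (!) (rev (sort \<beta>\<^sub>1))"
  define B\<^sub>2 where "B\<^sub>2 = (!) (rev (sort \<beta>\<^sub>2))"
  have A: "0 \<le> A i" if "i < n" for i
    unfolding A_def using pos(1) len(1) that by (rule nth_sort_all)
  have Amono: "A i \<le> A j" if "i \<le> j" "j < n" for i j
    using that len unfolding A_def by (simp add: sorted_nth_mono)
  have B: "0 < B\<^sub>1 i" "0 < B\<^sub>2 i" if "i < n" for i
    unfolding B\<^sub>1_def B\<^sub>2_def
    using nth_sort_all(2)[OF pos(2) len(2) that] nth_sort_all(2)[OF pos(3) len(3) that] by auto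
  show ?thesis
    unfolding A_def[symmetric] B\<^sub>1_def[symmetric] B\<^sub>2_def[symmetric]
  proof (rule gamma_conv_leI[OF B refl])
    fix x :: real assume x: "0 < x"
    have "0 \<le> (\<Sum>i<n. (A i * exp (- B\<^sub>1 i * x)) * (B\<^sub>1 i - B\<^sub>2 i))"
    proof (rule sum_mult_nonneg_Abel)
      have "sorted (rev (rev (sort \<beta>\<^sub>1)))" by simp
      then have "B\<^sub>1 j \<le> B\<^sub>1 i" if "i \<le> j" "j < n" for i j
        using that len unfolding B\<^sub>1_def by (simp add: sorted_rev_iff_nth_mono del: rev_rev_ident)
      then show "A i * exp (- B\<^sub>1 i * x) \<le> A j * exp (- B\<^sub>1 j * x)" if "i \<le> j" "j < n" for i j
        using that x A[of i] A[of j] Amono by (intro mult_mono) auto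
      show "0 \<le> (\<Sum>i=k..<n. B\<^sub>1 i - B\<^sub>2 i)" if "k < n" for k
        using weak_sup_major_tails[OF maj len(2,3) that] by (simp add: sum_subtractf B\<^sub>1_def B\<^sub>2_def)
    qed (use A in auto)
    then have "0 \<le> x * (\<Sum>i<n. (A i * exp (- B\<^sub>1 i * x)) * (B\<^sub>1 i - B\<^sub>2 i))" using x by simp
    also have "\<dots> = (\<Sum>i<n. A i * (exp (- B\<^sub>1 i * x) * ((B\<^sub>1 i - B\<^sub>2 i) * x)))"
      by (simp add: sum_distrib_left mult_ac)
    also have "\<dots> \<le> (\<Sum>i<n. A i * (exp (- B\<^sub>2 i * x) - exp (- B\<^sub>1 i * x)))"
    proof (intro sum_mono mult_left_mono)
      fix i
      have "exp (- B\<^sub>1 i * x) * ((B\<^sub>1 i - B\<^sub>2 i) * x) \<le> exp (- B\<^sub>1 i * x) * (exp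
          ((B\<^sub>1 i - B\<^sub>2 i) * x) - 1)"
        using exp_ge_add_one_self[of "(B\<^sub>1 i - B\<^sub>2 i) * x"] by
            (intro mult_left_mono[OF _ exp_ge_zero]) linarith
      also have "\<dots> = exp (- B\<^sub>2 i * x) - exp (- B\<^sub>1 i * x)"
        by (simp add: right_diff_distrib exp_add[symmetric] left_diff_distrib)
      finally show "exp (- B\<^sub>1 i * x) * ((B\<^sub>1 i - B\<^sub>2 i) * x) \<le> \<dots>" .
    qed (use A in auto)
    finally show "(\<Sum>i<n. A i * exp (- B\<^sub>1 i * x)) \<le> (\<Sum>i<n. A i * exp (- B\<^sub>2 i * x))"
      by (simp add: right_diff_distrib sum_subtractf)
  qed auto
qed

text \<open>Both endpoint vectors of log-rates are decreasing, hence so is every point of the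
  segment between them. The weights in the pointwise inequality therefore increase at each \<tau>,
  and Abel summation gives its sign.\<close>

lemma gamma_st_le_log_weak_sup_major:
  assumes maj: "weak_sup_major (map ln \<beta>\<^sub>1) (map ln \<beta>\<^sub>2)" and len: "length \<alpha> = n" "length \<beta>\<^sub>1
      = n" "length \<beta>\<^sub>2 = n"
    and pos: "\<forall>i<n. 0 \<le> \<alpha> ! i" "\<forall>i<n. 0 < \<beta>\<^sub>1 ! i" "\<forall>i<n. 0 < \<beta>\<^sub>2 ! i"
  shows "gamma_st_le n ((!) (sort \<alpha>)) ((!) (rev (sort \<beta>\<^sub>1))) ((!) (sort \<alpha>)) ((!) (rev (sort \<beta>\<^sub>2)))"
proof -
  define A where "A = (!) (sort \<alpha>)"
  define b where "b = (!) (rev (sort (map ln \<beta>\<^sub>1)))"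
  define c where "c = (!) (rev (sort (map ln \<beta>\<^sub>2)))"
  have A: "0 \<le> A i" if "i < n" for i
    unfolding A_def using pos(1) len(1) that by (rule nth_sort_all)
  have Amono: "A i \<le> A j" if "i \<le> j" "j < n" for i j
    using that len unfolding A_def by (simp add: sorted_nth_mono)
  have dec: "rev (sort xs) ! j \<le> rev (sort xs) ! i" if "i
      \<le> j" "j < length xs" for i j and xs :: "real list"
  proof -
    have "sorted (rev (rev (sort xs)))" by simp
    then show ?thesis using that by (simp add: sorted_rev_iff_nth_mono del: rev_rev_ident)
  qed
  have exp_sort: "exp (rev (sort (map ln \<beta>)) ! i) = rev (sort \<beta>) ! i"
    if "length \<beta> = n" "\<forall>i<n. 0 < \<beta> ! i" "i < n" for \<beta> :: "real list" and i
  proof -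
    have pos: "\<forall>y\<in>set \<beta>. 0 < y" using that by (auto simp: in_set_conv_nth)
    then have "ln x \<le> ln y" if "x \<in> set (sort \<beta>)" "y \<in> set (sort \<beta>)" "x \<le> y" for x y
    proof -
      have "0 < x" "0 < y" using pos that by auto
      then show ?thesis using that(3) by simp
    qed
    then have "sorted (map ln (sort \<beta>))"
      unfolding sorted_map by (rule sorted_wrt_mono_rel[OF _ sorted_sort[of \<beta>]])
    then have "sort (map ln \<beta>) = map ln (sort \<beta>)" by (intro properties_for_sort) simp
    moreover have "0 < rev (sort \<beta>) ! i" using that(2,1,3) by (rule nth_sort_all)
    ultimately show ?thesis using that by (simp add: rev_map)
  qed
  have "gamma_st_le n A (\<lambda>i. exp (b i)) A (\<lambda>i. exp (c i))"
    unfolding gamma_st_le_def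
  proof (rule laplace_st_le_log_segment[OF A])
    fix \<tau> x :: real assume \<tau>: "0 \<le> \<tau>" "\<tau> \<le> 1" and x: "0 \<le> x"
    let ?e = "\<lambda>i. exp (- exp ((1 - \<tau>) * b i + \<tau> * c i) * x)"
    have "0 \<le> (\<Sum>i<n. (A i * ?e i) * (b i - c i))"
    proof (rule sum_mult_nonneg_Abel)
      fix i j assume ij: "i \<le> j" "j < n"
      have "(1 - \<tau>) * b j + \<tau> * c j \<le> (1 - \<tau>) * b i + \<tau> * c i"
        using \<tau> ij len unfolding b_def c_def by (intro add_mono mult_left_mono dec) simp_all
      then have "?e i \<le> ?e j" using x by (simp add: mult_right_mono)
      then show "A i * ?e i \<le> A j * ?e j"
        using ij A[of i] A[of j] Amono by (intro mult_mono) auto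
    next
      show "0 \<le> (\<Sum>i=k..<n. b i - c i)" if "k < n" for k
        using weak_sup_major_tails[OF maj, of n k] len that by (simp add: sum_subtractf b_def c_def)
    qed (use A in auto)
    also have "\<dots> = - (\<Sum>i<n. A i * (c i - b i) * ?e i)"
      unfolding sum_negf[symmetric] by (intro sum.cong) (auto simp: algebra_simps)
    finally show "(\<Sum>i<n. A i * (c i - b i) * ?e i) \<le> 0" by simp
  qed
  moreover have "gamma_exponent n A (\<lambda>i. exp (b i)) = gamma_exponent n A ((!) (rev (sort \<beta>\<^sub>1)))"
    "gamma_exponent n A (\<lambda>i. exp (c i)) = gamma_exponent n A ((!) (rev (sort \<beta>\<^sub>2)))"
    unfolding b_def c_def
    by (rule gamma_exponent_cong[OF refl exp_sort]; use len pos in simp)+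
  ultimately show ?thesis by (simp add: gamma_st_le_def A_def)
qed

theorem theorem1p2:
  fixes n :: nat
    and \<alpha>\<^sub>1 \<beta>\<^sub>1 \<alpha>\<^sub>2 \<beta>\<^sub>2 :: "real list"
    and M\<^sub>1 :: "'a measure" and X\<^sub>1 :: "nat \<Rightarrow> 'a \<Rightarrow> real"
    and M\<^sub>2 :: "'b measure" and X\<^sub>2 :: "nat \<Rightarrow> 'b \<Rightarrow> real"
  defines "G\<^sub>1 \<equiv> (\<lambda>\<omega>. \<Sum>i<n. X\<^sub>1 i \<omega>)"
    and "G\<^sub>2 \<equiv> (\<lambda>\<omega>. \<Sum>i<n. X\<^sub>2 i \<omega>)"
  assumes "n \<ge> 1"
    and "length \<alpha>\<^sub>1 = n" "length \<beta>\<^sub>1 = n" "length \<alpha>\<^sub>2 = n" "length \<beta>\<^sub>2 = n"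
    and "\<forall>i<n. \<alpha>\<^sub>1 ! i > 0" "\<forall>i<n. \<beta>\<^sub>1 ! i > 0" "\<forall>i<n. \<alpha>\<^sub>2 ! i > 0" "\<forall>i<n. \<beta>\<^sub>2 ! i > 0"
    and "prob_space M\<^sub>1" "prob_space M\<^sub>2"
    and "prob_space.indep_vars M\<^sub>1 (\<lambda>_. borel) X\<^sub>1 {..<n}"
    and "prob_space.indep_vars M\<^sub>2 (\<lambda>_. borel) X\<^sub>2 {..<n}"
    and "\<forall>i<n. distributed M\<^sub>1 lborel (X\<^sub>1 i) (\<lambda>t. ennreal (gamma_density (\<alpha>\<^sub>1 ! i) (\<beta>\<^sub>1 ! i) t))"
    and "\<forall>i<n. distributed M\<^sub>2 lborel (X\<^sub>2 i) (\<lambda>t. ennreal (gamma_density (\<alpha>\<^sub>2 ! i) (\<beta>\<^sub>2 ! i) t))"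
  shows
    "(arr_le (\<alpha>\<^sub>2, \<beta>\<^sub>2) (\<alpha>\<^sub>1, \<beta>\<^sub>1) \<longrightarrow> conv_le M\<^sub>1 G\<^sub>1 M\<^sub>2 G\<^sub>2) \<and>
     (arr_eq (\<alpha>\<^sub>2, \<beta>\<^sub>2) (increasing_vec \<alpha>\<^sub>2, decreasing_vec \<beta>\<^sub>2) \<and>
        weak_sub_major \<alpha>\<^sub>1 \<alpha>\<^sub>2 \<and> weak_sup_major \<beta>\<^sub>1 \<beta>\<^sub>2 \<longrightarrow> conv_le M\<^sub>1 G\<^sub>1 M\<^sub>2 G\<^sub>2) \<and>
     (rc_le n (\<alpha>\<^sub>1, \<beta>\<^sub>1) (\<alpha>\<^sub>2, \<beta>\<^sub>2) \<longrightarrow> conv_le M\<^sub>1 G\<^sub>1 M\<^sub>2 G\<^sub>2) \<and>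
     (arr_eq (\<alpha>\<^sub>2, \<beta>\<^sub>2) (increasing_vec \<alpha>\<^sub>2, decreasing_vec \<beta>\<^sub>2) \<and>
        weak_sub_major \<alpha>\<^sub>1 \<alpha>\<^sub>2 \<and> weak_sup_major (map ln \<beta>\<^sub>1) (map ln \<beta>\<^sub>2) \<longrightarrow> st_le M\<^sub>1 G\<^sub>1 M\<^sub>2 G\<^sub>2) \<and>
     (rc_le n (\<alpha>\<^sub>1, map ln \<beta>\<^sub>1) (\<alpha>\<^sub>2, map ln \<beta>\<^sub>2) \<longrightarrow> st_le M\<^sub>1 G\<^sub>1 M\<^sub>2 G\<^sub>2)"
proof -
  note len = assms(4-7) and pos = assms(8-11)
  have law1: "nonneg_law (distr M\<^sub>1 borel G\<^sub>1)" "G\<^sub>1 \<in> borel_measurable M\<^sub>1"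
    "\<And>s. 0 \<le> s \<Longrightarrow> laplace (distr M\<^sub>1 borel G\<^sub>1) s = exp (gamma_exponent n ((!) \<alpha>\<^sub>1) ((!) \<beta>\<^sub>1) s)"
    unfolding G\<^sub>1_def by (rule gamma_sum_law[OF assms(12,14), where \<alpha>="(!) \<alpha>\<^sub>1" and \<beta>="(!) \<beta>\<^sub>1"];
        use assms(16) pos in simp)+
  have law2: "nonneg_law (distr M\<^sub>2 borel G\<^sub>2)" "G\<^sub>2 \<in> borel_measurable M\<^sub>2"
    "\<And>s. 0 \<le> s \<Longrightarrow> laplace (distr M\<^sub>2 borel G\<^sub>2) s = exp (gamma_exponent n ((!) \<alpha>\<^sub>2) ((!) \<beta>\<^sub>2) s)"
    unfolding G\<^sub>2_def by (rule gamma_sum_law[OF assms(13,15), where \<alpha>="(!) \<alpha>\<^sub>2" and \<beta>="(!) \<beta>\<^sub>2"];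
        use assms(17) pos in simp)+
  have conv: "conv_le M\<^sub>1 G\<^sub>1 M\<^sub>2 G\<^sub>2" if "gamma_conv_le n ((!) \<alpha>\<^sub>1) ((!) \<beta>\<^sub>1) ((!) \<alpha>\<^sub>2) ((!) \<beta>\<^sub>2)"
    by (rule conv_leI[OF law1(1) law2(1) that[unfolded gamma_conv_le_def]])
      (simp add: law1 law2 exp_add[symmetric])
  have st: "st_le M\<^sub>1 G\<^sub>1 M\<^sub>2 G\<^sub>2" if "gamma_st_le n ((!) \<alpha>\<^sub>1) ((!) \<beta>\<^sub>1) ((!) \<alpha>\<^sub>2) ((!) \<beta>\<^sub>2)"
    using that law1 law2
    by (intro st_leI) (simp_all add: gamma_st_le_def laplace_st_le_def poly_laplace_def)
  \<comment> \<open>At the two ends of a chain the shapes are positive, so the truncation used in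
    between disappears.\<close>
  have max1: "gamma_exponent n (\<lambda>i. max 0 (\<alpha>\<^sub>1 ! i)) \<beta> = gamma_exponent n ((!) \<alpha>\<^sub>1) \<beta>"
    and max2: "gamma_exponent n (\<lambda>i. max 0 (\<alpha>\<^sub>2 ! i)) \<beta> = gamma_exponent n ((!) \<alpha>\<^sub>2) \<beta>" for \<beta>
    by (rule gamma_exponent_cong; use pos in \<open>simp add: less_imp_le max_absorb2\<close>)+
  have ln1: "gamma_exponent n \<alpha> (\<lambda>i. exp (map ln \<beta>\<^sub>1 ! i)) = gamma_exponent n \<alpha> ((!) \<beta>\<^sub>1)"
    and ln2: "gamma_exponent n \<alpha> (\<lambda>i. exp (map ln \<beta>\<^sub>2 ! i)) = gamma_exponent n \<alpha> ((!) \<beta>\<^sub>2)" for \<alpha>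
    by (rule gamma_exponent_cong; use pos len in simp)+
  have sorted2: "gamma_conv_le n ((!) (sort \<alpha>\<^sub>2)) ((!) (rev (sort \<beta>\<^sub>2))) ((!) \<alpha>\<^sub>2) ((!) \<beta>\<^sub>2)"
    if "arr_eq (\<alpha>\<^sub>2, \<beta>\<^sub>2) (increasing_vec \<alpha>\<^sub>2, decreasing_vec \<beta>\<^sub>2)"
    using arr_eqD(6)[OF that, of n id id] len
    by (intro gamma_conv_le_same) (simp add: increasing_vec_def decreasing_vec_def)
  have sort_pos: "0 \<le> sort \<alpha>\<^sub>2 ! i" "0 < rev (sort \<beta>\<^sub>1) ! i" "0 < rev (sort \<beta>\<^sub>2) ! i" if "i < n" for i
    using nth_sort_all(1)[OF pos(3) len(3) that] nth_sort_all(2)[OF pos(2) len(2) that]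
      nth_sort_all(2)[OF pos(4) len(4) that] by auto
  \<comment> \<open>The comparison of oppositely ordered vectors passes through the sorted \<alpha>
    of the second pair combined with the decreasing \<beta> of the first: shapes change before
    rates.\<close>
  have shapes: "gamma_conv_le n ((!) \<alpha>\<^sub>1) ((!) \<beta>\<^sub>1) ((!) (sort \<alpha>\<^sub>2)) ((!) (rev (sort \<beta>\<^sub>1)))"
      if "weak_sub_major \<alpha>\<^sub>1 \<alpha>\<^sub>2"
    using that len pos assms(3) by (intro gamma_conv_le_weak_sub_major) auto
  show ?thesis
  proof (intro conjI impI; (elim conjE)?)
    assume "arr_le (\<alpha>\<^sub>2, \<beta>\<^sub>2) (\<alpha>\<^sub>1, \<beta>\<^sub>1)"
    then obtain \<phi> where \<phi>: "\<phi> \<noteq> []" "arr_eq (\<alpha>\<^sub>2, \<beta>\<^sub>2) (sort \<alpha>\<^sub>2, hd \<phi>)"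
      "arr_eq (sort \<alpha>\<^sub>2, last \<phi>) (\<alpha>\<^sub>1, \<beta>\<^sub>1)" "successively sorting_swap \<phi>"
      by (auto simp: arr_le_def increasing_vec_def)
    have D: "length (hd \<phi>) = n" "mset \<beta>\<^sub>2 = mset (hd \<phi>)" using arr_eqD[OF \<phi>(2), of n] len by auto
    have "\<forall>i<n. 0 < hd \<phi> ! i"
      using pos(4) len D mset_eq_setD[OF D(2)] by (metis in_set_conv_nth)
    \<comment> \<open>The chain starts at the arrangement of the second pair and ends at that of the
      first, so the second sum is the larger one.\<close>
    then have "gamma_conv_le n ((!) (sort \<alpha>\<^sub>2)) ((!) (last \<phi>)) ((!) (sort \<alpha>\<^sub>2)) ((!) (hd \<phi>))"
      using \<phi> D len sort_pos by (intro gamma_conv_le_sorting_swaps) auto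
    then show "conv_le M\<^sub>1 G\<^sub>1 M\<^sub>2 G\<^sub>2"
      using arr_eqD(6)[OF \<phi>(2), of n id id] arr_eqD(6)[OF \<phi>(3), of n id id] len
      by (intro conv) (simp add: gamma_conv_le_def)
  next
    assume "arr_eq (\<alpha>\<^sub>2, \<beta>\<^sub>2) (increasing_vec \<alpha>\<^sub>2, decreasing_vec \<beta>\<^sub>2)" "weak_sub_major \<alpha>\<^sub>1 \<alpha>\<^sub>2"
        "weak_sup_major \<beta>\<^sub>1 \<beta>\<^sub>2"
    note as = this
    have "gamma_conv_le n ((!) (sort \<alpha>\<^sub>2)) ((!) (rev (sort \<beta>\<^sub>1))) ((!) (sort \<alpha>\<^sub>2)) ((!) (rev
        (sort \<beta>\<^sub>2)))"
      using as(3) len pos by (intro gamma_conv_le_weak_sup_major) (auto simp: less_imp_le)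
    from gamma_conv_le_trans[OF gamma_conv_le_trans[OF shapes[OF as(2)] this] sorted2[OF as(1)]]
    show "conv_le M\<^sub>1 G\<^sub>1 M\<^sub>2 G\<^sub>2" by (rule conv)
  next
    assume "rc_le n (\<alpha>\<^sub>1, \<beta>\<^sub>1) (\<alpha>\<^sub>2, \<beta>\<^sub>2)"
    from gamma_conv_le_rc_le[OF this] pos show "conv_le M\<^sub>1 G\<^sub>1 M\<^sub>2 G\<^sub>2"
      by (intro conv) (simp add: gamma_conv_le_def max1 max2)
  next
    assume as: "arr_eq (\<alpha>\<^sub>2, \<beta>\<^sub>2) (increasing_vec \<alpha>\<^sub>2, decreasing_vec \<beta>\<^sub>2)" "weak_sub_major \<alpha>\<^sub>1 \<alpha>\<^sub>2"
      "weak_sup_major (map ln \<beta>\<^sub>1) (map ln \<beta>\<^sub>2)"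
    \<comment> \<open>The change of shapes is inherited from the convolution order; only the change
      of rates rests on logarithms.\<close>
    have "gamma_st_le n ((!) \<alpha>\<^sub>1) ((!) \<beta>\<^sub>1) ((!) (sort \<alpha>\<^sub>2)) ((!) (rev (sort \<beta>\<^sub>1)))"
      using shapes[OF as(2)] pos by (intro gamma_conv_imp_st_le) (auto simp: less_imp_le)
    moreover have "gamma_st_le n ((!) (sort \<alpha>\<^sub>2)) ((!) (rev (sort \<beta>\<^sub>1))) ((!) (sort \<alpha>\<^sub>2)) ((!) (rev
        (sort \<beta>\<^sub>2)))"
      using as(3) len pos by (intro gamma_st_le_log_weak_sup_major) (auto simp: less_imp_le)
    moreover have "gamma_st_le n ((!) (sort \<alpha>\<^sub>2)) ((!) (rev (sort \<beta>\<^sub>2))) ((!) \<alpha>\<^sub>2) ((!) \<beta>\<^sub>2)"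
      using sorted2[OF as(1)] sort_pos by (intro gamma_conv_imp_st_le) auto
    ultimately show "st_le M\<^sub>1 G\<^sub>1 M\<^sub>2 G\<^sub>2" by (intro st) (rule gamma_st_le_trans[OF gamma_st_le_trans])
  next
    assume "rc_le n (\<alpha>\<^sub>1, map ln \<beta>\<^sub>1) (\<alpha>\<^sub>2, map ln \<beta>\<^sub>2)"
    from gamma_st_le_rc_le[OF this] show "st_le M\<^sub>1 G\<^sub>1 M\<^sub>2 G\<^sub>2"
      by (intro st) (simp add: gamma_st_le_def max1 max2 ln1 ln2)
  qed
qed

end
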